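(* Let $1\le p\le q$ be integers and consider the finitized bead process with parameters $p,q$ (defined in the context). For each line $t\in\{1,\dots,p+q-1\}$, the projection (marginal) of its joint probability density function to $x^{(t)}$ is, for $x_1>\dots>x_{r(t)}$ in $(0,1)$, the density $$p_t(x_1,\dots,x_{r(t)})=Z_t^{-1}\,\Delta^2(x_1,\dots,x_{r(t)})\prod_{i=1}^{r(t)}f_t(x_i),\qquad f_t(x)=(1-x)^{|q-t|}\,x^{|p-t|},$$ where $Z_t$ is a normalizing constant.
   Context: Finitized bead process: fix integers $1\le p\le q$. On each line $t=1,\dots,p+q-1$ (a copy of the segment $(0,1)$) there are $r(t)$ particles, where $r(t)=t$ for $t\le p$, $r(t)=p$ for $p\le t\le q$, $r(t)=p+q-t$ for $t\ge q$. Their positions are $x^{(t)}=\{x^{(t)}_1>\dots>x^{(t)}_{r(t)}\}\subset(0,1)$. The joint probability density function (with respect to Lebesgue measure) of all the positions is proportional to $$\prod_{t=1}^{p-1}\chi(x^{(t)},x^{(t+1)})\prod_{t=p}^{q-1}\chi(x^{(t)},x^{(t+1)}\cup\{0\})\prod_{t=q}^{p+q-1}\chi(x^{(t)},x^{(t+1)}\cup\{0,1\}),$$ where $x^{(p+q)}=\emptyset$ and, for finite sets $y=\{y_1>\dots>y_m\}$, $z=\{z_1>\dots>z_{m+1}\}$, $\chi(y,z)=1$ if $z_{m+1}<y_m<z_m<\dots<z_2<y_1<z_1$ and $\chi(y,z)=0$ otherwise. $\Delta(x_1,\dots,x_m)=\prod_{1\le i<j\le m}(x_i-x_j)$ is the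 Vandermonde determinant. *)

theory Defs
  imports "HOL-Probability.Probability"
begin

text \<open>Number of particles on line \<open>t\<close>; note that \<open>num_particles p q (p + q) = 0\<close>.\<close>

definition num_particles :: "nat \<Rightarrow> nat \<Rightarrow> nat \<Rightarrow> nat" where
  "num_particles p q t = (if t \<le> p then t else if t \<le> q then p else p + q - t)"

text \<open>
  The interlacing indicator of two finite sets of reals. The lists \<open>ys\<close> and \<open>zs\<close> enumerate the
  sets in decreasing order, indexed from 0, so \<open>ys ! i\<close> is the
  point usually written with index \<open>i + 1\<close>. The value is 0 if the cardinalities do not fit.
\<close>

definition interlace_chi :: "real set \<Rightarrow> real set \<Rightarrow> real" where
  "interlace_chi y z =
     (let ys = rev (sorted_list_of_set y); zs = rev (sorted_list_of_set z) in
      if card z = card y + 1 \<and> (\<forall>i<card y. zs ! (i + 1) < ys ! i \<and> ys ! i < zs ! i)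
      then 1 else 0)"

definition ordered_points :: "nat \<Rightarrow> (nat \<Rightarrow> real) set" where
  "ordered_points m =
     {x. (\<forall>i\<in>{1..m}. 0 < x i \<and> x i < 1) \<and> (\<forall>i\<in>{1..m}. \<forall>j\<in>{1..m}. i < j \<longrightarrow> x j < x i)}"

text \<open>
  A configuration of the bead process is \<open>x :: nat \<Rightarrow> nat \<Rightarrow> real\<close>, where \<open>x t i\<close> is the position of
  the \<open>i\<close>-th particle from the right on line \<open>t\<close>; both indices start at 1. The reference measure is
  Lebesgue measure in all the coordinates.
\<close>

definition line_measure :: "nat \<Rightarrow> nat \<Rightarrow> nat \<Rightarrow> (nat \<Rightarrow> real) measure" where
  "line_measure p q t = (\<Pi>\<^sub>M i\<in>{1..num_particles p q t}. lborel)"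

definition config_measure :: "nat \<Rightarrow> nat \<Rightarrow> (nat \<Rightarrow> nat \<Rightarrow> real) measure" where
  "config_measure p q = (\<Pi>\<^sub>M t\<in>{1..p + q - 1}. line_measure p q t)"

definition line_set :: "nat \<Rightarrow> nat \<Rightarrow> (nat \<Rightarrow> nat \<Rightarrow> real) \<Rightarrow> nat \<Rightarrow> real set" where
  "line_set p q x t = x t ` {1..num_particles p q t}"

definition bead_weight :: "nat \<Rightarrow> nat \<Rightarrow> (nat \<Rightarrow> nat \<Rightarrow> real) \<Rightarrow> real" where
  "bead_weight p q x =
     (if \<forall>t\<in>{1..p + q - 1}. x t \<in> ordered_points (num_particles p q t) then
        (\<Prod>t\<in>{1..<p}. interlace_chi (line_set p q x t) (line_set p q x (t + 1))) *
        (\<Prod>t\<in>{p..<q}. interlace_chi (line_set p q x t) (line_set p q x (t + 1) \<union> {0})) *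
        (\<Prod>t\<in>{q..p + q - 1}. interlace_chi (line_set p q x t) (line_set p q x (t + 1) \<union> {0, 1}))
      else 0)"

definition bead_pdf :: "nat \<Rightarrow> nat \<Rightarrow> (nat \<Rightarrow> nat \<Rightarrow> real) \<Rightarrow> real" where
  "bead_pdf p q x = bead_weight p q x / (LINT y|config_measure p q. bead_weight p q y)"

definition bead_process :: "nat \<Rightarrow> nat \<Rightarrow> (nat \<Rightarrow> nat \<Rightarrow> real) measure" where
  "bead_process p q = density (config_measure p q) (\<lambda>x. ennreal (bead_pdf p q x))"

definition vandermonde :: "nat \<Rightarrow> (nat \<Rightarrow> real) \<Rightarrow> real" where
  "vandermonde m x = (\<Prod>i\<in>{1..m}. \<Prod>j\<in>{i<..m}. x i - x j)"

definition line_weight :: "nat \<Rightarrow> nat \<Rightarrow> nat \<Rightarrow> real \<Rightarrow> real" where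
  "line_weight p q t x =
     (1 - x) ^ nat \<bar>int q - int t\<bar> * x ^ nat \<bar>int p - int t\<bar>"

definition line_pdf :: "nat \<Rightarrow> nat \<Rightarrow> nat \<Rightarrow> real \<Rightarrow> (nat \<Rightarrow> real) \<Rightarrow> real" where
  "line_pdf p q t Z x =
     (if x \<in> ordered_points (num_particles p q t)
      then inverse Z * (vandermonde (num_particles p q t) x)\<^sup>2 * (\<Prod>i\<in>{1..num_particles p q t}. line_weight p q t (x i))
      else 0)"

end

theory Submission
  imports Defs "Jordan_Normal_Form.Determinant"
begin

text \<open>
  The density is a product of one-step kernels, so the lines form a Markov chain, and the marginal
  on line \<open>t\<close> is the product of the function obtained by integrating out the lines before \<open>t\<close> and
  the one obtained by integrating out the lines after \<open>t\<close>. With truncated subtraction, these are up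
  to constants \<open>\<Delta>(x) \<Prod>(1 - x\<^sub>i)\<^bsup>t - q\<^esup> x\<^sub>i\<^bsup>t - p\<^esup>\<close> and
  \<open>\<Delta>(x) \<Prod>(1 - x\<^sub>i)\<^bsup>q - t\<^esup> x\<^sub>i\<^bsup>p - t\<^esup>\<close>. In each of the six cases (three kinds of lines,
  two directions) the induction step is an instance of the Dixon--Anderson integral with integer
  exponents: for \<open>a\<^sub>0 > \<dots> > a\<^sub>n\<close>, integrating \<open>\<Delta>(u) \<Prod>(a\<^sub>0 - u\<^sub>i)\<^sup>l (u\<^sub>i - a\<^sub>n)\<^sup>k\<close> over the
  points \<open>u\<^sub>1, \<dots>, u\<^sub>n\<close> in the successive gaps gives a constant times
  \<open>\<Delta>(a\<^sub>1, \<dots>, a\<^bsub>n - 1\<^esub>) (a\<^sub>0 - a\<^sub>n)\<^bsup>k + l + 1\<^esup>\<close> and the factors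
  \<open>(a\<^sub>0 - a\<^sub>i)\<^bsup>l + 1\<^esup> (a\<^sub>i - a\<^sub>n)\<^bsup>k + 1\<^esup>\<close>, \<open>0 < i < n\<close>. To prove it, write \<open>\<Delta>(u)\<close> as a
  determinant in polynomials \<open>P\<^sub>j\<close> for which \<open>(a\<^sub>0 - y)\<^sup>l (y - a\<^sub>n)\<^sup>k P\<^sub>j(y)\<close>, \<open>j \<ge> 1\<close>, has a primitive
  vanishing at both ends, and integrate row by row.
\<close>

subsection \<open>Determinants\<close>

lemma det_lower_triangular_mat:
  fixes f :: "nat \<Rightarrow> nat \<Rightarrow> 'a::comm_ring_1"
  assumes "\<And>i j. i < j \<Longrightarrow> j < n \<Longrightarrow> f i j = 0"
  shows "Determinant.det (mat n n (\<lambda>(i, j). f i j)) = (\<Prod>i<n. f i i)"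
proof -
  have "Determinant.det (mat n n (\<lambda>(i, j). f i j)) = prod_list (diag_mat (mat n n (\<lambda>(i, j). f i j)))"
    by (rule Determinant.det_lower_triangular[where n = n]) (use assms in auto)
  also have "\<dots> = (\<Prod>i<n. f i i)"
    by (simp add: prod_list_diag_prod atLeast0LessThan)
  finally show ?thesis .
qed

lemma det_upper_triangular_mat:
  fixes f :: "nat \<Rightarrow> nat \<Rightarrow> 'a::comm_ring_1"
  assumes "\<And>i j. j < i \<Longrightarrow> i < n \<Longrightarrow> f i j = 0"
  shows "Determinant.det (mat n n (\<lambda>(i, j). f i j)) = (\<Prod>i<n. f i i)"
proof -
  have "Determinant.det (mat n n (\<lambda>(i, j). f i j)) = prod_list (diag_mat (mat n n (\<lambda>(i, j). f i j)))"
    by (rule Determinant.det_upper_triangular[where n = n]) (use assms in \<open>auto simp: upper_triangular_def\<close>)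
  also have "\<dots> = (\<Prod>i<n. f i i)"
    by (simp add: prod_list_diag_prod atLeast0LessThan)
  finally show ?thesis .
qed

lemma poly_eq_sum_lessThan:
  fixes P :: "'a::comm_semiring_1 poly"
  assumes "degree P < n"
  shows "poly P x = (\<Sum>m<n. x ^ m * coeff P m)"
proof -
  have "poly P x = (\<Sum>m\<le>degree P. coeff P m * x ^ m)"
    by (rule poly_altdef)
  also have "\<dots> = (\<Sum>m<n. coeff P m * x ^ m)"
    by (rule sum.mono_neutral_left) (use assms in \<open>auto simp: coeff_eq_0\<close>)
  finally show ?thesis by (simp add: mult.commute)
qed

text \<open>Expanding each \<open>P j\<close> in monomials factors the matrix as the power matrix of
  the nodes times the matrix of coefficients. Since \<open>P j\<close> has degree at most
  \<open>j\<close>, the latter is upper triangular and contributes its diagonal.\<close>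

lemma det_poly_eq_prod_coeff_mult:
  fixes x :: "nat \<Rightarrow> 'a::comm_ring_1"
  assumes "\<And>j. j < n \<Longrightarrow> degree (P j) \<le> j"
  shows "Determinant.det (mat n n (\<lambda>(i, j). poly (P j) (x i))) =
    Determinant.det (mat n n (\<lambda>(i, j). x i ^ j)) * (\<Prod>j<n. coeff (P j) j)"
proof -
  have "mat n n (\<lambda>(i, j). poly (P j) (x i)) =
      mat n n (\<lambda>(i, j). x i ^ j) * mat n n (\<lambda>(i, j). coeff (P j) i)"
  proof (rule eq_matI, goal_cases)
    case (1 i j)
    then have "i < n" "j < n" by simp_all
    have "poly (P j) (x i) = (\<Sum>m<n. x i ^ m * coeff (P j) m)"
      by (rule poly_eq_sum_lessThan) (use assms[OF \<open>j < n\<close>] \<open>j < n\<close> in linarith)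
    then show ?case
      using \<open>i < n\<close> \<open>j < n\<close> by (simp add: scalar_prod_def atLeast0LessThan)
  qed simp_all
  then have "Determinant.det (mat n n (\<lambda>(i, j). poly (P j) (x i))) =
      Determinant.det (mat n n (\<lambda>(i, j). x i ^ j)) * Determinant.det (mat n n (\<lambda>(i, j). coeff (P j) i))"
    by (simp add: Determinant.det_mult[of _ n])
  moreover have "Determinant.det (mat n n (\<lambda>(i, j). coeff (P j) i)) = (\<Prod>j<n. coeff (P j) j)"
    by (rule det_upper_triangular_mat) (meson assms coeff_eq_0 le_less_trans less_trans)
  ultimately show ?thesis by simp
qed

text \<open>Serves in two guises: with the nodes of a Vandermonde matrix, and with a constant node,
  where it describes the powers of \<open>y - B\<close> in \<open>jacobi_basis\<close>.\<close>

lemma monic_linear_prod: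
  fixes x :: "nat \<Rightarrow> 'a::comm_ring_1"
  shows "degree (\<Prod>m<j. [:- x m, 1:]) \<le> j \<and> coeff (\<Prod>m<j. [:- x m, 1:]) j = 1"
proof (induction j)
  case (Suc j)
  have "(\<Prod>m<Suc j. [:- x m, 1:]) = pCons 0 (\<Prod>m<j. [:- x m, 1:]) - Polynomial.smult (x j) (\<Prod>m<j. [:- x m, 1:])"
    by (simp add: mult.commute)
  moreover have "coeff (\<Prod>m<j. [:- x m, 1:]) (Suc j) = 0"
    using Suc by (simp add: coeff_eq_0 le_imp_less_Suc)
  moreover have "degree (pCons 0 (\<Prod>m<j. [:- x m, 1:])) \<le> Suc j"
    using Suc by (meson Suc_le_mono degree_pCons_le order_trans)
  moreover have "degree (Polynomial.smult (x j) (\<Prod>m<j. [:- x m, 1:])) \<le> Suc j"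
    using Suc by (meson degree_smult_le le_Suc_eq order_trans)
  ultimately show ?case
    using Suc by (simp add: degree_diff_le)
qed simp

text \<open>In the Newton basis at the nodes the matrix is lower triangular, because the
  \<open>j\<close>-th polynomial vanishes at \<open>x i\<close> for \<open>i < j\<close>. That basis
  is monic, so passing to it from the monomials leaves the determinant unchanged.\<close>

lemma det_vandermonde_matrix:
  fixes x :: "nat \<Rightarrow> 'a::comm_ring_1"
  shows "Determinant.det (mat n n (\<lambda>(i, j). x i ^ j)) = (\<Prod>j<n. \<Prod>i<j. x j - x i)"
proof -
  let ?P = "\<lambda>j. \<Prod>m<j. [:- x m, 1:]"
  have "Determinant.det (mat n n (\<lambda>(i, j). poly (?P j) (x i))) = (\<Prod>j<n. poly (?P j) (x j))"
    by (rule det_lower_triangular_mat) (auto simp: poly_prod intro!: prod_zero)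
  then show ?thesis
    using det_poly_eq_prod_coeff_mult[of n ?P x] monic_linear_prod[of x]
    by (simp add: poly_prod)
qed

text \<open>Left multiplication by the lower triangular matrix of ones telescopes row
  \<open>i\<close> to \<open>R 0 j - R (Suc i) j\<close>. The hypotheses then leave at most one
  nonzero entry in the last row, along which the determinant is expanded. In the application
  \<open>R i j\<close> is a primitive at the \<open>i\<close>-th boundary point, so that the rows
  are its increments over the gaps.\<close>

lemma det_row_differences:
  fixes R :: "nat \<Rightarrow> nat \<Rightarrow> 'a::comm_ring_1"
  assumes R0: "\<And>j. j < m \<Longrightarrow> R 0 (Suc j) = 0" and Rm: "\<And>j. j < m \<Longrightarrow> R (Suc m) (Suc j) = 0"
  shows "Determinant.det (mat (Suc m) (Suc m) (\<lambda>(i, j). R i j - R (Suc i) j)) =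
    (R 0 0 - R (Suc m) 0) * Determinant.det (mat m m (\<lambda>(i, j). R (Suc i) (Suc j)))"
proof -
  let ?n = "Suc m"
  let ?L = "mat ?n ?n (\<lambda>(i, j). if j \<le> i then 1 else 0 :: 'a)"
  let ?D = "mat ?n ?n (\<lambda>(i, j). R i j - R (Suc i) j)"
  let ?E = "mat ?n ?n (\<lambda>(i, j). R 0 j - R (Suc i) j)"
  have "?L * ?D = ?E"
  proof (rule eq_matI, goal_cases)
    case (1 i j)
    then have ij: "i < ?n" "j < ?n" by simp_all
    have "scalar_prod (Matrix.row ?L i) (Matrix.col ?D j) = (\<Sum>k<?n. (if k \<le> i then 1 else 0) * (R k j - R (Suc k) j))"
      using ij by (simp add: scalar_prod_def atLeast0LessThan del: sum.lessThan_Suc)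
    also have "\<dots> = (\<Sum>k<?n. if k \<le> i then R k j - R (Suc k) j else 0)"
      by (intro sum.cong) auto
    also have "\<dots> = (\<Sum>k\<in>{..<Suc i}. R k j - R (Suc k) j)"
      by (rule sum.mono_neutral_cong_right) (use ij in auto)
    also have "\<dots> = R 0 j - R (Suc i) j"
      by (rule sum_lessThan_telescope')
    finally show ?case using ij by simp
  qed simp_all
  moreover have "Determinant.det ?L = 1"
    by (subst det_lower_triangular_mat) auto
  ultimately have "Determinant.det ?D = Determinant.det ?E"
    using Determinant.det_mult[of ?L ?n ?D] by simp
  also have "\<dots> = (\<Sum>j<?n. ?E $$ (m, j) * cofactor ?E m j)"
    by (rule laplace_expansion_row) auto
  also have "\<dots> = ?E $$ (m, 0) * cofactor ?E m 0"
    by (subst sum.lessThan_Suc_shift) (simp add: Rm R0)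
  also have "\<dots> = (R 0 0 - R (Suc m) 0) * ((-1) ^ m * Determinant.det (mat m m (\<lambda>(i, j). - R (Suc i) (Suc j))))"
  proof -
    have "mat_delete ?E m 0 = mat m m (\<lambda>(i, j). - R (Suc i) (Suc j))"
      by (rule eq_matI) (auto simp: mat_delete_def R0)
    then show ?thesis by (simp add: cofactor_def)
  qed
  \<comment> \<open>The minor has \<open>m\<close> rows, so extracting its minus signs gives a
    second \<open>(-1) ^ m\<close>, which cancels the cofactor sign.\<close>
  also have "mat m m (\<lambda>(i, j). - R (Suc i) (Suc j)) = (-1) \<cdot>\<^sub>m mat m m (\<lambda>(i, j). R (Suc i) (Suc j))"
    by (rule eq_matI) auto
  also have "(-1) ^ m * Determinant.det \<dots> = Determinant.det (mat m m (\<lambda>(i, j). R (Suc i) (Suc j)))"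
    by (simp add: det_smult flip: power_mult_distrib mult.assoc)
  finally show ?thesis .
qed

text \<open>Each Leibniz term is a product of functions of separate coordinates, so its integral
  over the product measure is the product of the one-dimensional integrals. Rows count from 0 and
  coordinates from 1, so row \<open>i\<close> carries the variable \<open>u (Suc i)\<close>.\<close>

lemma has_bochner_integral_det_PiM:
  fixes f :: "nat \<Rightarrow> nat \<Rightarrow> 'a \<Rightarrow> real"
  assumes "product_sigma_finite M"
    and int: "\<And>i j. i < n \<Longrightarrow> j < n \<Longrightarrow> integrable (M (Suc i)) (f i j)"
  shows "has_bochner_integral (PiM {1..n} M)
      (\<lambda>u. Determinant.det (mat n n (\<lambda>(i, j). f i j (u (Suc i)))))
      (Determinant.det (mat n n (\<lambda>(i, j). integral\<^sup>L (M (Suc i)) (f i j))))"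
proof -
  interpret product_sigma_finite M by fact
  have eq: "Determinant.det (mat n n (\<lambda>(i, j). g i j)) =
      (\<Sum>p\<in>{p. p permutes {0..<n}}. signof p * (\<Prod>k\<in>{1..n}. g (k - 1) (p (k - 1))))"
    for g :: "nat \<Rightarrow> nat \<Rightarrow> real"
  proof -
    have "(\<Prod>i = 0..<n. mat n n (\<lambda>(i, j). g i j) $$ (i, p i)) = (\<Prod>k\<in>{1..n}. g (k - 1) (p (k - 1)))"
      if "p permutes {0..<n}" for p
    proof -
      have "(\<Prod>i = 0..<n. mat n n (\<lambda>(i, j). g i j) $$ (i, p i)) = (\<Prod>i = 0..<n. g i (p i))"
        using permutes_in_image[OF that] by (intro prod.cong) auto
      also have "\<dots> = (\<Prod>k\<in>{1..n}. g (k - 1) (p (k - 1)))"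
        by (rule prod.reindex_bij_witness[of _ "\<lambda>k. k - 1" Suc]) auto
      finally show ?thesis .
    qed
    then show ?thesis
      by (subst Determinant.det_def') (auto intro!: sum.cong)
  qed
  have "has_bochner_integral (PiM {1..n} M) (\<lambda>u. \<Prod>k\<in>{1..n}. f (k - 1) (p (k - 1)) (u (Suc (k - 1))))
     (\<Prod>k\<in>{1..n}. integral\<^sup>L (M (Suc (k - 1))) (f (k - 1) (p (k - 1))))"
    if "p permutes {0..<n}" for p
  proof -
    have i: "integrable (M k) (f (k - 1) (p (k - 1)))" if "k \<in> {1..n}" for k
      using that int[of "k - 1" "p (k - 1)"] permutes_in_image[OF \<open>p permutes {0..<n}\<close>, of "k - 1"]
      by auto
    have "has_bochner_integral (PiM {1..n} M) (\<lambda>u. \<Prod>k\<in>{1..n}. f (k - 1) (p (k - 1)) (u k))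
       (\<Prod>k\<in>{1..n}. integral\<^sup>L (M k) (f (k - 1) (p (k - 1))))"
      using product_integrable_prod[of "{1..n}", OF _ i] product_integral_prod[of "{1..n}", OF _ i]
      by (simp add: has_bochner_integral_iff)
    moreover have "(\<lambda>u. \<Prod>k\<in>{1..n}. f (k - 1) (p (k - 1)) (u (Suc (k - 1)))) = (\<lambda>u. \<Prod>k\<in>{1..n}. f (k - 1) (p (k - 1)) (u k))"
      by (intro ext prod.cong) auto
    moreover have "(\<Prod>k\<in>{1..n}. integral\<^sup>L (M (Suc (k - 1))) (f (k - 1) (p (k - 1)))) = (\<Prod>k\<in>{1..n}. integral\<^sup>L (M k) (f (k - 1) (p (k - 1))))"
      by (intro prod.cong) auto
    ultimately show ?thesis
      by (simp only:)
  qed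
  then show ?thesis
    unfolding eq by (intro has_bochner_integral_sum has_bochner_integral_mult_right) auto
qed

lemma det_scale_rows:
  fixes g :: "nat \<Rightarrow> nat \<Rightarrow> 'a::comm_ring_1"
  shows "Determinant.det (mat n n (\<lambda>(i, j). r i * g i j)) =
    (\<Prod>i<n. r i) * Determinant.det (mat n n (\<lambda>(i, j). g i j))"
proof -
  have "mat n n (\<lambda>(i, j). r i * g i j) =
      mat n n (\<lambda>(i, j). if i = j then r i else 0) * mat n n (\<lambda>(i, j). g i j)"
  proof (rule eq_matI, goal_cases)
    case (1 i j)
    then have ij: "i < n" "j < n" by simp_all
    have "(\<Sum>k<n. (if i = k then r i else 0) * g k j) = (\<Sum>k<n. if k = i then r i * g i j else 0)"
      by (intro sum.cong) auto
    then show ?case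
      using ij by (simp add: scalar_prod_def atLeast0LessThan)
  qed simp_all
  moreover have "Determinant.det (mat n n (\<lambda>(i, j). if i = j then r i else 0)) = (\<Prod>i<n. r i)"
    by (subst det_lower_triangular_mat) auto
  ultimately show ?thesis
    by (simp add: Determinant.det_mult[of _ n])
qed

lemma prod_atLeast1_atMost_Suc_shift:
  fixes g :: "nat \<Rightarrow> 'a::comm_monoid_mult"
  shows "(\<Prod>i\<in>{1..Suc n}. g i) = g 1 * (\<Prod>i\<in>{1..n}. g (Suc i))"
proof -
  have "(\<Prod>i\<in>{1..Suc n}. g i) = g 1 * (\<Prod>i\<in>{Suc 1..Suc n}. g i)"
    by (rule prod.atLeast_Suc_atMost) simp
  also have "(\<Prod>i\<in>{Suc 1..Suc n}. g i) = (\<Prod>i\<in>{1..n}. g (Suc i))"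
    by (rule prod.shift_bounds_cl_Suc_ivl)
  finally show ?thesis .
qed

section \<open>The Vandermonde product\<close>

lemma vandermonde_0 [simp]: "vandermonde 0 x = 1"
  by (simp add: vandermonde_def)

lemma vandermonde_Suc:
  "vandermonde (Suc n) x = vandermonde n x * (\<Prod>i\<in>{1..n}. x i - x (Suc n))"
proof -
  have "(\<Prod>i\<in>{1..n}. \<Prod>j\<in>{i<..Suc n}. x i - x j) =
      (\<Prod>i\<in>{1..n}. (\<Prod>j\<in>{i<..n}. x i - x j) * (x i - x (Suc n)))"
  proof (rule prod.cong)
    fix i assume "i \<in> {1..n}"
    then have "{i<..Suc n} = insert (Suc n) {i<..n}" by auto
    then show "(\<Prod>j\<in>{i<..Suc n}. x i - x j) = (\<Prod>j\<in>{i<..n}. x i - x j) * (x i - x (Suc n))"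
      by (simp add: mult.commute)
  qed simp
  then show ?thesis
    by (simp add: vandermonde_def prod.distrib)
qed

lemma vandermonde_Suc_shift:
  "vandermonde (Suc n) x = (\<Prod>i\<in>{1..n}. x 1 - x (Suc i)) * vandermonde n (\<lambda>i. x (Suc i))"
proof (induction n)
  case (Suc n)
  have "(\<Prod>i\<in>{1..Suc n}. x i - x (Suc (Suc n))) = (x 1 - x (Suc (Suc n))) * (\<Prod>i\<in>{1..n}. x (Suc i) - x (Suc (Suc n)))"
    by (rule prod_atLeast1_atMost_Suc_shift)
  then show ?case
    by (subst vandermonde_Suc, subst Suc) (simp add: vandermonde_Suc[of n])
qed (simp add: vandermonde_def)

lemma vandermonde_cong:
  "(\<And>i. i \<in> {1..n} \<Longrightarrow> x i = y i) \<Longrightarrow> vandermonde n x = vandermonde n y"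
  unfolding vandermonde_def by (intro prod.cong refl) auto

text \<open>The determinant formula takes the later point minus the earlier one,
  \<open>vandermonde\<close> the earlier minus the later. There is one sign for each pair, and the
  index \<open>j\<close> on the left has \<open>j\<close> predecessors.\<close>

lemma prod_diff_eq_vandermonde:
  "(\<Prod>j<n. \<Prod>i<j. x (Suc j) - x (Suc i)) = (- 1) ^ (\<Sum>j<n. j) * vandermonde n x"
proof (induction n)
  case (Suc n)
  have "(\<Prod>i<n. x (Suc n) - x (Suc i)) = (\<Prod>i<n. (- 1) * (x (Suc i) - x (Suc n)))"
    by simp
  also have "\<dots> = (- 1) ^ n * (\<Prod>i<n. x (Suc i) - x (Suc n))"
    by (subst prod.distrib) simp
  also have "(\<Prod>i<n. x (Suc i) - x (Suc n)) = (\<Prod>i\<in>{1..n}. x i - x (Suc n))"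
    by (rule prod.reindex_bij_witness[of _ "\<lambda>k. k - 1" Suc]) auto
  finally show ?case
    using Suc by (simp add: vandermonde_Suc power_add)
qed simp

lemma vandermonde_pos:
  assumes "\<And>i j. 1 \<le> i \<Longrightarrow> i < j \<Longrightarrow> j \<le> n \<Longrightarrow> x j < x i"
  shows "vandermonde n x > 0"
  unfolding vandermonde_def using assms by (intro prod_pos) auto

section \<open>Primitives and a polynomial basis for the Jacobi weight\<close>

lemma ex_pderiv_eq:
  fixes P :: "'a::field_char_0 poly"
  shows "\<exists>Q. pderiv Q = P"
proof
  let ?Q = "\<Sum>i\<le>degree P. monom (coeff P i / of_nat (Suc i)) (Suc i)"
  have "pderiv ?Q = (\<Sum>i\<le>degree P. pderiv (monom (coeff P i / of_nat (Suc i)) (Suc i)))"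
    using higher_pderiv_sum[of 1] by simp
  also have "\<dots> = (\<Sum>i\<le>degree P. monom (coeff P i) i)"
    by (intro sum.cong) (simp_all add: pderiv_monom del: of_nat_Suc)
  also have "\<dots> = P"
    by (rule poly_as_sum_of_monoms)
  finally show "pderiv ?Q = P" .
qed

text \<open>Interlacing is strict, so the gaps are open intervals; they differ from the closed ones
  of the fundamental theorem by two null points.\<close>

lemma has_bochner_integral_FTC_Ioo_real:
  fixes f F :: "real \<Rightarrow> real"
  assumes "a \<le> b" and "\<And>x. DERIV F x :> f x" and "continuous_on UNIV f"
  shows "has_bochner_integral lborel (\<lambda>x. f x * indicator {a<..<b} x) (F b - F a)"
proof -
  have f: "isCont f x" for x
    using assms(3) by (simp add: continuous_on_eq_continuous_at)
  have [measurable]: "f \<in> borel_measurable borel"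
    by (rule borel_measurable_continuous_onI) fact
  have "has_bochner_integral lborel (\<lambda>x. f x * indicator {a..b} x) (F b - F a)"
    by (rule has_bochner_integral_FTC_Icc_real) (use assms f in auto)
  moreover have "AE x in lborel. f x * indicator {a..b} x = f x * indicator {a<..<b} x"
    using AE_lborel_singleton[of a] AE_lborel_singleton[of b]
    by eventually_elim (auto simp: indicator_def)
  ultimately show ?thesis
    by (subst (asm) has_bochner_integral_cong_AE) auto
qed

text \<open>
  \<open>(A - y)\<^sup>l (y - B)\<^sup>k\<close> times the polynomial with index \<open>j \<ge> 1\<close> is the derivative of
  \<open>(A - y)\<^bsup>l+1\<^esup> (y - B)\<^bsup>k+j\<^esup>\<close>, which vanishes at \<open>A\<close> and \<open>B\<close>.
\<close>

definition jacobi_basis :: "nat \<Rightarrow> nat \<Rightarrow> real \<Rightarrow> real \<Rightarrow> nat \<Rightarrow> real poly" where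
  "jacobi_basis k l A B j = (case j of 0 \<Rightarrow> 1 | Suc i \<Rightarrow>
     Polynomial.smult (real (k + j)) ([:A, - 1:] * [:- B, 1:] ^ i) - Polynomial.smult (real (Suc l)) ([:- B, 1:] ^ j))"

lemma jacobi_basis_0 [simp]: "jacobi_basis k l A B 0 = 1"
  by (simp add: jacobi_basis_def)

text \<open>For positive \<open>j\<close> the two summands contribute \<open>- (k + j)\<close> and
  \<open>- (l + 1)\<close> to the top coefficient. It never vanishes, so passing from monomials to
  this basis multiplies the determinant by a nonzero constant.\<close>

lemma degree_jacobi_basis: "degree (jacobi_basis k l A B j) \<le> j"
  and coeff_jacobi_basis: "coeff (jacobi_basis k l A B j) j = (if j = 0 then 1 else - real (k + l + j + 1))"
proof -
  note m = monic_linear_prod[of "\<lambda>_. B"]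
  have "degree (jacobi_basis k l A B j) \<le> j \<and>
    coeff (jacobi_basis k l A B j) j = (if j = 0 then 1 else - real (k + l + j + 1))"
  proof (cases j)
    case (Suc i)
    have "degree ([:A, - 1:] * [:- B, 1:] ^ i) \<le> Suc i"
      using degree_mult_le[of "[:A, - 1:]" "[:- B, 1:] ^ i"] m[of i] by simp
    moreover have "coeff ([:- B, 1:] ^ i) (Suc i) = 0"
      using m[of i] by (intro coeff_eq_0) simp
    moreover have "degree (Polynomial.smult (real (Suc l)) ([:- B, 1:] ^ j)) \<le> j"
      using m[of j] by (simp del: of_nat_Suc power_Suc)
    ultimately show ?thesis
      using m[of i] m[of j] Suc by (auto simp: jacobi_basis_def intro!: degree_diff_le simp del: power_Suc)
  qed simp
  then show "degree (jacobi_basis k l A B j) \<le> j"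
    "coeff (jacobi_basis k l A B j) j = (if j = 0 then 1 else - real (k + l + j + 1))"
    by auto
qed

lemma DERIV_jacobi_primitive:
  fixes A B y :: real
  shows "((\<lambda>y. (A - y) ^ Suc l * (y - B) ^ (k + Suc i)) has_real_derivative
    (A - y) ^ l * (y - B) ^ k * poly (jacobi_basis k l A B (Suc i)) y) (at y)"
  by (rule derivative_eq_intros refl | simp)+
     (simp add: jacobi_basis_def poly_power power_add algebra_simps)

subsection \<open>The interlacing integral\<close>

text \<open>\<open>C\<close> is chosen before \<open>a\<close>: it depends only on \<open>m\<close>,
  \<open>k\<close> and \<open>l\<close>, so it comes out as a constant when the points
  \<open>a\<close> are integrated in turn. The signs of the determinants are not compared along the
  way; nonnegativity of the integrand settles them at the end.\<close>

lemma nn_integral_interlacing: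
  "\<exists>C>0. \<forall>a :: nat \<Rightarrow> real. (\<forall>i\<le>m. a (Suc i) < a i) \<longrightarrow>
    (\<integral>\<^sup>+u. ennreal (if \<forall>i\<in>{1..Suc m}. a i < u i \<and> u i < a (i - 1)
        then vandermonde (Suc m) u * (\<Prod>i\<in>{1..Suc m}. (a 0 - u i) ^ l * (u i - a (Suc m)) ^ k) else 0)
      \<partial>(\<Pi>\<^sub>M i\<in>{1..Suc m}. lborel)) =
    ennreal (C * (vandermonde m a * (\<Prod>i\<in>{1..m}. (a 0 - a i) ^ Suc l * (a i - a (Suc m)) ^ Suc k)
      * (a 0 - a (Suc m)) ^ Suc (k + l)))"
proof -
  let ?n = "Suc m"
  interpret product_sigma_finite "\<lambda>_::nat. lborel :: real measure" ..
  \<comment> \<open>A polynomial primitive of the beta weight \<open>(1 - s) ^ l * s ^ k\<close>.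
    Its increment \<open>\<beta>\<close> over the unit interval is the beta integral with parameters
    \<open>k + 1\<close> and \<open>l + 1\<close>.\<close>
  obtain H :: "real poly" where H: "pderiv H = [:1, - 1:] ^ l * [:0, 1:] ^ k"
    using ex_pderiv_eq by blast
  have dH: "DERIV (poly H) s :> (1 - s) ^ l * s ^ k" for s
    using poly_DERIV[of H s] by (simp add: H poly_power)
  have "poly H 0 < poly H 1"
    by (rule DERIV_pos_imp_increasing_open[where f = "poly H"])
       (use dH in \<open>force intro!: continuous_on_poly\<close>)+
  define \<beta> where "\<beta> = poly H 1 - poly H 0"
  \<comment> \<open>The product of the leading coefficients of \<open>jacobi_basis\<close>, which
    relates the determinant in that basis to the Vandermonde determinant.\<close>
  define K :: real where "K = (\<Prod>j<?n. if j = 0 then 1 else - real (k + l + j + 1))"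
  have "\<beta> > 0" "K \<noteq> 0"
    using \<open>poly H 0 < poly H 1\<close> by (auto simp: \<beta>_def K_def)
  have main: "(\<integral>\<^sup>+u. ennreal (if \<forall>i\<in>{1..?n}. a i < u i \<and> u i < a (i - 1)
        then vandermonde ?n u * (\<Prod>i\<in>{1..?n}. (a 0 - u i) ^ l * (u i - a ?n) ^ k) else 0)
      \<partial>(\<Pi>\<^sub>M i\<in>{1..?n}. lborel)) =
    ennreal (\<beta> / \<bar>K\<bar> * (vandermonde m a * (\<Prod>i\<in>{1..m}. (a 0 - a i) ^ Suc l * (a i - a ?n) ^ Suc k)
      * (a 0 - a ?n) ^ Suc (k + l)))" (is "(\<integral>\<^sup>+u. ennreal (?F u) \<partial>?M) = ennreal (_ * ?R)")
    if a: "\<And>i. i \<le> m \<Longrightarrow> a (Suc i) < a i" for a :: "nat \<Rightarrow> real"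
  proof -
    have dec: "a j < a i" if "i < j" "j \<le> ?n" for i j
      using that
    proof (induction j)
      case (Suc j)
      then show ?case using a[of j] by (cases "i = j") auto
    qed simp
    have dec_le: "a j \<le> a i" if "i \<le> j" "j \<le> ?n" for i j
      using dec[of i j] that by (cases "i = j") auto
    define A B where "A = a 0" and "B = a ?n"
    have "B < A"
      using dec by (simp add: A_def B_def)
    define P where "P = jacobi_basis k l A B"
    define w where "w y = (A - y) ^ l * (y - B) ^ k" for y
    \<comment> \<open>\<open>\<Phi> j\<close> is a primitive of \<open>w\<close> times
      \<open>P j\<close>. For index 0 it is \<open>H\<close> rescaled from the unit interval to the
      one from \<open>B\<close> to \<open>A\<close>; the power of \<open>A - B\<close> collects the
      scaling of the weight and of the variable. For positive indices it vanishes at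
      \<open>A\<close> and \<open>B\<close>, as \<open>det_row_differences\<close> requires.\<close>
    define \<Phi> where "\<Phi> j y = (case j of 0 \<Rightarrow> (A - B) ^ Suc (k + l) * poly H ((y - B) / (A - B))
      | Suc i \<Rightarrow> (A - y) ^ Suc l * (y - B) ^ (k + j))" for j y
    define f where "f i j y = w y * poly (P j) y * indicator {a (Suc i)<..<a i} y" for i j y
    have d\<Phi>: "DERIV (\<Phi> j) y :> w y * poly (P j) y" for j y
    proof (cases j)
      case 0
      have "DERIV (\<lambda>y. (A - B) ^ Suc (k + l) * poly H ((y - B) / (A - B))) y :>
        (A - B) ^ Suc (k + l) * (((1 - (y - B) / (A - B)) ^ l * ((y - B) / (A - B)) ^ k) * (1 / (A - B)))"
        using \<open>B < A\<close> by (intro DERIV_cmult DERIV_chain2[OF dH]) (auto intro!: derivative_eq_intros)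
      also have "1 - (y - B) / (A - B) = (A - y) / (A - B)"
        using \<open>B < A\<close> by (simp add: field_simps)
      also have "(A - B) ^ Suc (k + l) * ((((A - y) / (A - B)) ^ l * ((y - B) / (A - B)) ^ k) * (1 / (A - B))) = w y"
        using \<open>B < A\<close> by (simp add: w_def power_divide power_add)
      moreover have "\<Phi> 0 = (\<lambda>y. (A - B) ^ Suc (k + l) * poly H ((y - B) / (A - B)))"
        by (simp add: \<Phi>_def fun_eq_iff)
      ultimately show ?thesis
        by (simp only: 0 P_def jacobi_basis_0 poly_1 mult_1_right)
    next
      case (Suc i)
      show ?thesis
        unfolding \<Phi>_def P_def w_def Suc nat.case by (rule DERIV_jacobi_primitive)
    qed
    have intf: "has_bochner_integral lborel (f i j) (\<Phi> j (a i) - \<Phi> j (a (Suc i)))" if "i < ?n" for i j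
      unfolding f_def
      by (rule has_bochner_integral_FTC_Ioo_real)
         (use a[of i] that d\<Phi> in \<open>auto simp: w_def intro!: continuous_intros\<close>)
    define D where "D = Determinant.det (mat ?n ?n (\<lambda>(i, j). \<Phi> j (a i) - \<Phi> j (a (Suc i))))"
    have "has_bochner_integral ?M (\<lambda>u. Determinant.det (mat ?n ?n (\<lambda>(i, j). f i j (u (Suc i)))))
      (Determinant.det (mat ?n ?n (\<lambda>(i, j). integral\<^sup>L lborel (f i j))))"
      by (rule has_bochner_integral_det_PiM[OF product_sigma_finite_axioms])
         (use intf in \<open>auto simp: has_bochner_integral_iff\<close>)
    also have "mat ?n ?n (\<lambda>(i, j). integral\<^sup>L lborel (f i j)) = mat ?n ?n (\<lambda>(i, j). \<Phi> j (a i) - \<Phi> j (a (Suc i)))"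
      by (rule eq_matI) (use intf in \<open>auto simp: has_bochner_integral_iff\<close>)
    finally have hb: "has_bochner_integral ?M (\<lambda>u. Determinant.det (mat ?n ?n (\<lambda>(i, j). f i j (u (Suc i))))) D"
      unfolding D_def .
    define s :: real where "s = (- 1) ^ (\<Sum>j<?n. j)"
    have "\<bar>s\<bar> = 1" by (simp add: s_def power_abs)
    \<comment> \<open>Taking weight and indicator out of each row leaves a determinant of
      polynomials, hence a multiple of the Vandermonde product; the indicators multiply to the
      interlacing condition.\<close>
    have det_f: "Determinant.det (mat ?n ?n (\<lambda>(i, j). f i j (u (Suc i)))) = (s * K) * ?F u" for u
    proof -
      let ?r = "\<lambda>i. w (u (Suc i)) * indicator {a (Suc i)<..<a i} (u (Suc i))"
      have "mat ?n ?n (\<lambda>(i, j). f i j (u (Suc i))) = mat ?n ?n (\<lambda>(i, j). ?r i * poly (P j) (u (Suc i)))"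
        by (rule eq_matI) (auto simp: f_def)
      then have "Determinant.det (mat ?n ?n (\<lambda>(i, j). f i j (u (Suc i)))) =
        (\<Prod>i<?n. ?r i) * Determinant.det (mat ?n ?n (\<lambda>(i, j). poly (P j) (u (Suc i))))"
        by (simp only: det_scale_rows)
      also have "Determinant.det (mat ?n ?n (\<lambda>(i, j). poly (P j) (u (Suc i)))) =
          (s * vandermonde ?n u) * (\<Prod>j<?n. coeff (P j) j)"
        unfolding s_def
        by (subst det_poly_eq_prod_coeff_mult)
           (simp_all only: P_def degree_jacobi_basis det_vandermonde_matrix prod_diff_eq_vandermonde)
      also have "(\<Prod>j<?n. coeff (P j) j) = K"
        by (simp only: P_def coeff_jacobi_basis K_def)
      also have "(\<Prod>i<?n. ?r i) = (\<Prod>i\<in>{1..?n}. w (u i) * indicator {a i<..<a (i - 1)} (u i))"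
        by (rule prod.reindex_bij_witness[of _ "\<lambda>k. k - 1" Suc]) auto
      also have "\<dots> = (if \<forall>i\<in>{1..?n}. a i < u i \<and> u i < a (i - 1) then \<Prod>i\<in>{1..?n}. w (u i) else 0)"
      proof (cases "\<forall>i\<in>{1..?n}. a i < u i \<and> u i < a (i - 1)")
        case True
        then show ?thesis by (auto intro!: prod.cong simp: indicator_def simp del: prod.cl_ivl_Suc)
      next
        case False
        then obtain i where "i \<in> {1..?n}" "u i \<notin> {a i<..<a (i - 1)}" by auto
        then have "(\<Prod>i\<in>{1..?n}. w (u i) * indicator {a i<..<a (i - 1)} (u i)) = 0"
          by (intro prod_zero bexI[of _ i]) auto
        with False show ?thesis by (simp only: if_False)
      qed
      finally show ?thesis
        by (simp add: w_def A_def B_def)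
    qed
    have F_nonneg: "?F u \<ge> 0" for u
    proof (cases "\<forall>i\<in>{1..?n}. a i < u i \<and> u i < a (i - 1)")
      case True
      have "u j < u i" if "1 \<le> i" "i < j" "j \<le> ?n" for i j
      proof -
        have "u j < a (j - 1)" "a i < u i" using True that by auto
        moreover have "a (j - 1) \<le> a i" using that by (intro dec_le) auto
        ultimately show ?thesis by simp
      qed
      then have "vandermonde ?n u > 0" by (rule vandermonde_pos)
      moreover have "a 0 - u i \<ge> 0" "u i - a ?n \<ge> 0" if "i \<in> {1..?n}" for i
      proof -
        have "u i < a (i - 1)" "a i < u i" using True that by auto
        moreover have "a (i - 1) \<le> a 0" using that by (intro dec_le) auto
        moreover have "a ?n \<le> a i" using that by (intro dec_le) auto
        ultimately show "a 0 - u i \<ge> 0" "u i - a ?n \<ge> 0" by simp_all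
      qed
      ultimately show ?thesis
        by (auto intro!: mult_nonneg_nonneg prod_nonneg)
    qed auto
    have intF: "has_bochner_integral ?M ?F (D / (s * K))"
    proof -
      have "has_bochner_integral ?M (\<lambda>u. (s * K) * ?F u / (s * K)) (D / (s * K))"
        using hb unfolding det_f by (rule has_bochner_integral_divide)
      then show ?thesis
        using \<open>K \<noteq> 0\<close> by (simp add: s_def del: prod.cl_ivl_Suc)
    qed
    have Deq: "\<bar>D\<bar> = \<beta> * ?R"
    proof -
      have "D = (\<Phi> 0 (a 0) - \<Phi> 0 (a ?n)) * Determinant.det (mat m m (\<lambda>(i, j). \<Phi> (Suc j) (a (Suc i))))"
        unfolding D_def by (rule det_row_differences) (simp_all add: \<Phi>_def A_def B_def)
      also have "\<Phi> 0 (a 0) - \<Phi> 0 (a ?n) = \<beta> * (A - B) ^ Suc (k + l)"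
        using \<open>B < A\<close> by (simp add: \<Phi>_def \<beta>_def algebra_simps flip: A_def B_def)
      \<comment> \<open>The weight factors at \<open>a (Suc i)\<close> are common to row
        \<open>i\<close> of the minor. What remains are powers of \<open>a (Suc i) - B\<close>, and
        the shift by \<open>B\<close> cancels in the differences.\<close>
      also have "mat m m (\<lambda>(i, j). \<Phi> (Suc j) (a (Suc i))) =
         mat m m (\<lambda>(i, j). ((A - a (Suc i)) ^ Suc l * (a (Suc i) - B) ^ Suc k) * (a (Suc i) - B) ^ j)"
        by (rule eq_matI) (simp_all add: \<Phi>_def power_add)
      also have "Determinant.det \<dots> = (\<Prod>i<m. (A - a (Suc i)) ^ Suc l * (a (Suc i) - B) ^ Suc k) *
          ((- 1) ^ (\<Sum>j<m. j) * vandermonde m a)"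
        by (simp only: det_scale_rows det_vandermonde_matrix flip: prod_diff_eq_vandermonde) simp
      also have "(\<Prod>i<m. (A - a (Suc i)) ^ Suc l * (a (Suc i) - B) ^ Suc k) =
          (\<Prod>i\<in>{1..m}. (A - a i) ^ Suc l * (a i - B) ^ Suc k)"
        by (rule prod.reindex_bij_witness[of _ "\<lambda>k. k - 1" Suc]) auto
      finally have D: "D = (\<beta> * (A - B) ^ Suc (k + l)) * ((\<Prod>i\<in>{1..m}. (A - a i) ^ Suc l * (a i - B) ^ Suc k) *
        ((- 1) ^ (\<Sum>j<m. j) * vandermonde m a))" .
      have pos: "vandermonde m a > 0" "A - B > 0" "(\<Prod>i\<in>{1..m}. (A - a i) ^ Suc l * (a i - B) ^ Suc k) > 0"
        using dec \<open>B < A\<close> by (auto intro!: vandermonde_pos prod_pos simp: A_def B_def simp del: power_Suc)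
      show ?thesis
        unfolding D abs_mult power_abs using pos \<open>\<beta> > 0\<close>
        by (simp add: A_def[symmetric] B_def[symmetric] abs_mult power_abs del: power_Suc)
    qed
    have "(\<integral>\<^sup>+u. ennreal (?F u) \<partial>?M) = ennreal (D / (s * K))"
      using intF F_nonneg by (subst nn_integral_eq_integral) (auto simp: has_bochner_integral_iff)
    \<comment> \<open>The integral of a nonnegative function is its own absolute value; this stands
      in for a comparison of the signs of \<open>D\<close>, \<open>s\<close> and
      \<open>K\<close>.\<close>
    also have "D / (s * K) = \<bar>D / (s * K)\<bar>"
    proof -
      have "integral\<^sup>L ?M ?F \<ge> 0" by (rule integral_nonneg_AE) (use F_nonneg in auto)
      moreover have "integral\<^sup>L ?M ?F = D / (s * K)" using intF by (simp only: has_bochner_integral_iff)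
      ultimately show ?thesis by (simp only: abs_of_nonneg)
    qed
    also have "\<dots> = \<beta> / \<bar>K\<bar> * ?R"
      using \<open>\<bar>s\<bar> = 1\<close> by (simp only: abs_divide abs_mult Deq) simp
    finally show ?thesis .
  qed
  show ?thesis
  proof (intro exI[of _ "\<beta> / \<bar>K\<bar>"] conjI allI impI)
    show "\<beta> / \<bar>K\<bar> > 0" using \<open>\<beta> > 0\<close> \<open>K \<noteq> 0\<close> by simp
  qed (rule main, simp)
qed

subsection \<open>Integrating out a Markov chain\<close>

text \<open>The leftmost coordinate occurs only in \<open>g a\<close> and in the kernel to its
  neighbour. Integrating it out replaces \<open>g a\<close> by \<open>c a\<close> times
  \<open>g (Suc a)\<close> and shortens the chain by one, while the function \<open>G\<close> of the
  last coordinate is carried along.\<close>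

lemma nn_integral_PiM_chain_left:
  fixes M :: "nat \<Rightarrow> 'a measure" and K :: "nat \<Rightarrow> 'a \<Rightarrow> 'a \<Rightarrow> ennreal"
  assumes "product_sigma_finite M" and "a \<le> t"
    and K: "\<And>s. a \<le> s \<Longrightarrow> s < t \<Longrightarrow> (\<lambda>(y, z). K s y z) \<in> borel_measurable (M s \<Otimes>\<^sub>M M (Suc s))"
    and g: "\<And>s. a \<le> s \<Longrightarrow> s \<le> t \<Longrightarrow> g s \<in> borel_measurable (M s)"
    and left: "\<And>s z. a \<le> s \<Longrightarrow> s < t \<Longrightarrow> z \<in> space (M (Suc s)) \<Longrightarrow>
      (\<integral>\<^sup>+y. g s y * K s y z \<partial>M s) = c s * g (Suc s) z"
    and G: "G \<in> borel_measurable (M t)"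
  shows "(\<integral>\<^sup>+x. g a (x a) * (\<Prod>s\<in>{a..<t}. K s (x s) (x (Suc s))) * G (x t) \<partial>PiM {a..t} M) =
    (\<Prod>s\<in>{a..<t}. c s) * (\<integral>\<^sup>+y. g t y * G y \<partial>M t)"
  using \<open>a \<le> t\<close> K g left
proof (induction a rule: inc_induct)
  case base
  interpret product_sigma_finite M by fact
  have [measurable]: "g t \<in> borel_measurable (M t)" using base by simp
  note G[measurable]
  show ?case
    using product_nn_integral_singleton[of "\<lambda>y. g t y * G y" t] by simp
next
  case (step a)
  interpret product_sigma_finite M by fact
  let ?I = "{Suc a..t}"
  note G[measurable]
  have [measurable]: "g a \<in> borel_measurable (M a)" using step by simp
  have K'[measurable]: "(\<lambda>x. K s (x s) (x (Suc s))) \<in> borel_measurable (PiM J M)"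
    if "s \<in> {a..<t}" "s \<in> J" "Suc s \<in> J" for s J
  proof -
    have "(\<lambda>x. (x s, x (Suc s))) \<in> PiM J M \<rightarrow>\<^sub>M M s \<Otimes>\<^sub>M M (Suc s)"
      using that by measurable
    from measurable_compose[OF this step.prems(1)[of s]] that show ?thesis
      by simp
  qed
  have I: "{a..t} = insert a ?I" "{a..<t} = insert a {Suc a..<t}"
    using step by auto
  have "(\<integral>\<^sup>+x. g a (x a) * (\<Prod>s\<in>{a..<t}. K s (x s) (x (Suc s))) * G (x t) \<partial>PiM {a..t} M) =
    (\<integral>\<^sup>+x. (\<integral>\<^sup>+y. g a y * (K a y (x (Suc a)) * (\<Prod>s\<in>{Suc a..<t}. K s (x s) (x (Suc s)))) * G (x t) \<partial>M a) \<partial>PiM ?I M)"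
    unfolding I(1)
  proof (subst product_nn_integral_insert, goal_cases)
    case 3
    have "a \<in> insert a ?I" "t \<in> insert a ?I" using step by auto
    then show ?case
      using step by (intro borel_measurable_times_ennreal borel_measurable_prod_ennreal K') auto
  next
    case 4
    have "(\<Prod>s\<in>{a..<t}. K s ((x(a := y)) s) ((x(a := y)) (Suc s))) =
      K a y (x (Suc a)) * (\<Prod>s\<in>{Suc a..<t}. K s (x s) (x (Suc s)))" for x y
      unfolding I(2) by (subst prod.insert) (auto intro!: arg_cong2[of _ _ _ _ "(*)"] prod.cong)
    then show ?case
      using step by (intro nn_integral_cong) simp
  qed auto
  also have "\<dots> = (\<integral>\<^sup>+x. c a * (g (Suc a) (x (Suc a)) * (\<Prod>s\<in>{Suc a..<t}. K s (x s) (x (Suc s))) * G (x t)) \<partial>PiM ?I M)"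
  proof (rule nn_integral_cong)
    fix x assume x: "x \<in> space (PiM ?I M)"
    then have xa: "x (Suc a) \<in> space (M (Suc a))"
      using step by (auto simp: space_PiM)
    have [measurable]: "(\<lambda>y. K a y (x (Suc a))) \<in> borel_measurable (M a)"
      using measurable_compose[OF measurable_Pair2'[OF xa] step.prems(1)[of a]] step by simp
    have "(\<integral>\<^sup>+y. g a y * (K a y (x (Suc a)) * (\<Prod>s\<in>{Suc a..<t}. K s (x s) (x (Suc s)))) * G (x t) \<partial>M a) =
       (\<integral>\<^sup>+y. (g a y * K a y (x (Suc a))) * ((\<Prod>s\<in>{Suc a..<t}. K s (x s) (x (Suc s))) * G (x t)) \<partial>M a)"
      by (simp add: mult_ac)
    also have "\<dots> = (c a * g (Suc a) (x (Suc a))) * ((\<Prod>s\<in>{Suc a..<t}. K s (x s) (x (Suc s))) * G (x t))"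
      using step xa by (subst nn_integral_multc) auto
    finally show "(\<integral>\<^sup>+y. g a y * (K a y (x (Suc a)) * (\<Prod>s\<in>{Suc a..<t}. K s (x s) (x (Suc s)))) * G (x t) \<partial>M a) =
      c a * (g (Suc a) (x (Suc a)) * (\<Prod>s\<in>{Suc a..<t}. K s (x s) (x (Suc s))) * G (x t))"
      by (simp add: mult_ac)
  qed
  also have "\<dots> = c a * (\<integral>\<^sup>+x. g (Suc a) (x (Suc a)) * (\<Prod>s\<in>{Suc a..<t}. K s (x s) (x (Suc s))) * G (x t) \<partial>PiM ?I M)"
  proof (rule nn_integral_cmult)
    have [measurable]: "g (Suc a) \<in> borel_measurable (M (Suc a))" using step by simp
    have "Suc a \<in> ?I" "t \<in> ?I" using step by auto
    then show "(\<lambda>x. g (Suc a) (x (Suc a)) * (\<Prod>s\<in>{Suc a..<t}. K s (x s) (x (Suc s))) * G (x t)) \<in> borel_measurable (PiM ?I M)"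
      using step by (intro borel_measurable_times_ennreal borel_measurable_prod_ennreal K') auto
  qed
  also have "(\<integral>\<^sup>+x. g (Suc a) (x (Suc a)) * (\<Prod>s\<in>{Suc a..<t}. K s (x s) (x (Suc s))) * G (x t) \<partial>PiM ?I M) =
    (\<Prod>s\<in>{Suc a..<t}. c s) * (\<integral>\<^sup>+y. g t y * G y \<partial>M t)"
    by (rule step.IH) (use step in auto)
  finally show ?case
    unfolding I(2) by (simp add: mult.assoc)
qed

text \<open>Induction on \<open>b\<close> peels off the last coordinate by integrating it against
  \<open>h\<close>; for \<open>b = t\<close> the left chain takes over. Since \<open>G\<close> is an
  arbitrary test function of coordinate \<open>t\<close>, the equation determines the marginal
  there.\<close>

lemma nn_integral_PiM_chain:
  fixes M :: "nat \<Rightarrow> 'a measure" and K :: "nat \<Rightarrow> 'a \<Rightarrow> 'a \<Rightarrow> ennreal"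
  assumes "product_sigma_finite M" and "a \<le> t" and "t \<le> b"
    and K: "\<And>s. a \<le> s \<Longrightarrow> s < b \<Longrightarrow> (\<lambda>(y, z). K s y z) \<in> borel_measurable (M s \<Otimes>\<^sub>M M (Suc s))"
    and g: "\<And>s. a \<le> s \<Longrightarrow> s \<le> t \<Longrightarrow> g s \<in> borel_measurable (M s)"
    and h: "\<And>s. t \<le> s \<Longrightarrow> s \<le> b \<Longrightarrow> h s \<in> borel_measurable (M s)"
    and left: "\<And>s z. a \<le> s \<Longrightarrow> s < t \<Longrightarrow> z \<in> space (M (Suc s)) \<Longrightarrow>
      (\<integral>\<^sup>+y. g s y * K s y z \<partial>M s) = c s * g (Suc s) z"
    and right: "\<And>s y. t \<le> s \<Longrightarrow> s < b \<Longrightarrow> y \<in> space (M s) \<Longrightarrow>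
      (\<integral>\<^sup>+z. K s y z * h (Suc s) z \<partial>M (Suc s)) = d s * h s y"
    and G: "G \<in> borel_measurable (M t)"
  shows "(\<integral>\<^sup>+x. g a (x a) * (\<Prod>s\<in>{a..<b}. K s (x s) (x (Suc s))) * h b (x b) * G (x t) \<partial>PiM {a..b} M) =
    (\<Prod>s\<in>{a..<t}. c s) * (\<Prod>s\<in>{t..<b}. d s) * (\<integral>\<^sup>+y. g t y * h t y * G y \<partial>M t)"
  using \<open>t \<le> b\<close> K h right
proof (induction b rule: dec_induct)
  case base
  have [measurable]: "h t \<in> borel_measurable (M t)" using base by simp
  note G[measurable]
  \<comment> \<open>With no coordinates to the right of \<open>t\<close>, the factor
    \<open>h t\<close> is absorbed into the test function of the left chain.\<close>
  show ?case
    using nn_integral_PiM_chain_left[OF \<open>product_sigma_finite M\<close> \<open>a \<le> t\<close> base(1) g left, of "\<lambda>y. h t y * G y"]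
    by (simp add: mult.assoc)
next
  case (step b)
  interpret product_sigma_finite M by fact
  let ?I = "{a..b}"
  note G[measurable]
  have "a \<le> b" using step \<open>a \<le> t\<close> by simp
  have g_a[measurable]: "g a \<in> borel_measurable (M a)" using g \<open>a \<le> t\<close> by simp
  have [measurable]: "h (Suc b) \<in> borel_measurable (M (Suc b))" using step by simp
  have K'[measurable]: "(\<lambda>x. K s (x s) (x (Suc s))) \<in> borel_measurable (PiM J M)"
    if "s \<in> {a..b}" "s \<in> J" "Suc s \<in> J" for s J
  proof -
    have "(\<lambda>x. (x s, x (Suc s))) \<in> PiM J M \<rightarrow>\<^sub>M M s \<Otimes>\<^sub>M M (Suc s)"
      using that by measurable
    from measurable_compose[OF this step.prems(1)[of s]] that show ?thesis
      by simp
  qed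
  have I: "{a..Suc b} = insert (Suc b) ?I" "{a..<Suc b} = insert b {a..<b}" "{t..<Suc b} = insert b {t..<b}"
    using step \<open>a \<le> b\<close> by auto
  let ?p = "\<lambda>x. \<Prod>s\<in>{a..<b}. K s (x s) (x (Suc s))"
  have "(\<integral>\<^sup>+x. g a (x a) * (\<Prod>s\<in>{a..<Suc b}. K s (x s) (x (Suc s))) * h (Suc b) (x (Suc b)) * G (x t) \<partial>PiM {a..Suc b} M) =
    (\<integral>\<^sup>+x. (\<integral>\<^sup>+y. g a (x a) * (K b (x b) y * ?p x) * h (Suc b) y * G (x t) \<partial>M (Suc b)) \<partial>PiM ?I M)"
    unfolding I(1)
  proof (subst product_nn_integral_insert, goal_cases)
    case 3
    have "a \<in> insert (Suc b) ?I" "t \<in> insert (Suc b) ?I" using step \<open>a \<le> t\<close> by auto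
    then show ?case
      using step \<open>a \<le> b\<close> by (intro borel_measurable_times_ennreal borel_measurable_prod_ennreal K') auto
  next
    case 4
    have "(\<Prod>s\<in>{a..<Suc b}. K s ((x(Suc b := y)) s) ((x(Suc b := y)) (Suc s))) = K b (x b) y * ?p x" for x y
      unfolding I(2) by (subst prod.insert) (auto intro!: arg_cong2[of _ _ _ _ "(*)"] prod.cong)
    then show ?case
      using step \<open>a \<le> b\<close> by (intro nn_integral_cong) simp
  qed auto
  also have "\<dots> = (\<integral>\<^sup>+x. d b * (g a (x a) * ?p x * h b (x b) * G (x t)) \<partial>PiM ?I M)"
  proof (rule nn_integral_cong)
    fix x assume x: "x \<in> space (PiM ?I M)"
    then have xb: "x b \<in> space (M b)"
      using \<open>a \<le> b\<close> by (auto simp: space_PiM)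
    have [measurable]: "(\<lambda>y. K b (x b) y) \<in> borel_measurable (M (Suc b))"
      using measurable_compose[OF measurable_Pair1'[OF xb] step.prems(1)[of b]] \<open>a \<le> b\<close> by simp
    have "(\<integral>\<^sup>+y. g a (x a) * (K b (x b) y * ?p x) * h (Suc b) y * G (x t) \<partial>M (Suc b)) =
       (\<integral>\<^sup>+y. (K b (x b) y * h (Suc b) y) * (g a (x a) * ?p x * G (x t)) \<partial>M (Suc b))"
      by (simp add: mult_ac)
    also have "\<dots> = (d b * h b (x b)) * (g a (x a) * ?p x * G (x t))"
      using step xb by (subst nn_integral_multc) auto
    finally show "(\<integral>\<^sup>+y. g a (x a) * (K b (x b) y * ?p x) * h (Suc b) y * G (x t) \<partial>M (Suc b)) =
      d b * (g a (x a) * ?p x * h b (x b) * G (x t))"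
      by (simp add: mult_ac)
  qed
  also have "\<dots> = d b * (\<integral>\<^sup>+x. g a (x a) * ?p x * h b (x b) * G (x t) \<partial>PiM ?I M)"
  proof (rule nn_integral_cmult)
    have [measurable]: "h b \<in> borel_measurable (M b)" using step by simp
    have "a \<in> ?I" "b \<in> ?I" "t \<in> ?I" using step \<open>a \<le> b\<close> \<open>a \<le> t\<close> by auto
    then show "(\<lambda>x. g a (x a) * ?p x * h b (x b) * G (x t)) \<in> borel_measurable (PiM ?I M)"
      using step by (intro borel_measurable_times_ennreal borel_measurable_prod_ennreal K') auto
  qed
  also have "(\<integral>\<^sup>+x. g a (x a) * ?p x * h b (x b) * G (x t) \<partial>PiM ?I M) =
    (\<Prod>s\<in>{a..<t}. c s) * (\<Prod>s\<in>{t..<b}. d s) * (\<integral>\<^sup>+y. g t y * h t y * G y \<partial>M t)"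
    by (rule step.IH) (use step in auto)
  finally show ?case
    unfolding I(3) by (simp add: mult_ac)
qed

subsection \<open>One step of the bead process\<close>

lemma num_particles_low: "s \<le> p \<Longrightarrow> num_particles p q s = s"
  and num_particles_high: "p \<le> q \<Longrightarrow> q \<le> s \<Longrightarrow> num_particles p q s = p + q - s"
  by (auto simp: num_particles_def)

lemma step_cases [consumes 1, case_names low mid high]:
  fixes p q s :: nat
  assumes "p \<le> q"
  obtains "s < p" "num_particles p q s = s" "num_particles p q (Suc s) = Suc s"
  | "p \<le> s" "s < q" "num_particles p q s = p" "num_particles p q (Suc s) = p"
  | "p \<le> s" "q \<le> s" "num_particles p q s = p + q - s" "num_particles p q (Suc s) = p + q - Suc s"
  using assms by (cases "s < p"; cases "s < q") (auto simp: num_particles_def)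

section \<open>Ordered points, padded lines and the weights\<close>

lemma ordered_pointsD:
  assumes "x \<in> ordered_points m"
  shows "1 \<le> i \<Longrightarrow> i \<le> m \<Longrightarrow> 0 < x i" "1 \<le> i \<Longrightarrow> i \<le> m \<Longrightarrow> x i < 1"
    "1 \<le> i \<Longrightarrow> i < j \<Longrightarrow> j \<le> m \<Longrightarrow> x j < x i"
  using assms by (auto simp: ordered_points_def)

text \<open>For \<open>i < j\<close> one has \<open>u j < a (j - 1)\<close>,
  \<open>a (j - 1) \<le> a i\<close> and \<open>a i < u i\<close>, so interlacing alone implies the
  order. Hence the domain of a one-step integral is a plain product of gaps.\<close>

lemma ordered_points_between:
  assumes a: "\<And>i j. i < j \<Longrightarrow> j \<le> n \<Longrightarrow> a j < a i" and "a 0 \<le> 1" "0 \<le> a n"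
    and u: "\<And>i. i \<in> {1..n} \<Longrightarrow> a i < u i \<and> u i < a (i - 1)"
  shows "u \<in> ordered_points n"
proof -
  have a': "a j \<le> a i" if "i \<le> j" "j \<le> n" for i j
    using a[of i j] that by (cases "i = j") auto
  have "0 < u i" "u i < 1" if "i \<in> {1..n}" for i
  proof -
    have "a i < u i" "u i < a (i - 1)" "a n \<le> a i" "a (i - 1) \<le> a 0"
      using u[OF that] that by (auto intro!: a')
    with assms show "0 < u i" "u i < 1" by linarith+
  qed
  moreover have "u j < u i" if "i \<in> {1..n}" "j \<in> {1..n}" "i < j" for i j
    using u[OF that(1)] u[OF that(2)] a'[of i "j - 1"] that by force
  ultimately show ?thesis
    by (auto simp: ordered_points_def)
qed

text \<open>
  \<open>padded_next p q s z\<close> enumerates, from index 1, the points \<open>z\<close> of line \<open>s + 1\<close> together with the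
  extra points 0, 1 that the density adds there; the points of line \<open>s\<close> lie in the gaps.
  Conversely \<open>padded_prev p q s y\<close> enumerates, from index 0, the points \<open>y\<close> of line \<open>s\<close>, with end points
  of \<open>(0, 1)\<close> added where necessary, so that the points of line \<open>s + 1\<close> lie in the gaps.
\<close>

definition padded_next :: "nat \<Rightarrow> nat \<Rightarrow> nat \<Rightarrow> (nat \<Rightarrow> real) \<Rightarrow> nat \<Rightarrow> real" where
  "padded_next p q s z i =
     (if s < p then z i
      else if s < q then (if i = Suc p then 0 else z i)
      else (if i = 1 then 1 else if i = Suc (p + q - s) then 0 else z (i - 1)))"

definition padded_prev :: "nat \<Rightarrow> nat \<Rightarrow> nat \<Rightarrow> (nat \<Rightarrow> real) \<Rightarrow> nat \<Rightarrow> real" where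
  "padded_prev p q s y i =
     (if s < p then (if i = 0 then 1 else if i = Suc s then 0 else y i)
      else if s < q then (if i = 0 then 1 else y i)
      else y (Suc i))"

definition step_interlacing :: "nat \<Rightarrow> nat \<Rightarrow> nat \<Rightarrow> (nat \<Rightarrow> real) \<Rightarrow> (nat \<Rightarrow> real) \<Rightarrow> bool" where
  "step_interlacing p q s y z \<longleftrightarrow>
     (\<forall>i\<in>{1..num_particles p q s}. padded_next p q s z (Suc i) < y i \<and> y i < padded_next p q s z i)"

text \<open>The order conditions of both lines are part of the kernel, so the case distinction in
  \<open>bead_weight\<close> distributes over the steps.\<close>

definition step_kernel :: "nat \<Rightarrow> nat \<Rightarrow> nat \<Rightarrow> (nat \<Rightarrow> real) \<Rightarrow> (nat \<Rightarrow> real) \<Rightarrow> real" where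
  "step_kernel p q s y z =
     of_bool (y \<in> ordered_points (num_particles p q s) \<and>
       z \<in> ordered_points (num_particles p q (Suc s)) \<and> step_interlacing p q s y z)"

text \<open>Up to a constant, what integrating out the lines before \<open>s\<close> leaves on line
  \<open>s\<close>. Truncated subtraction keeps the exponents at 0 up to lines \<open>q\<close> and
  \<open>p\<close>. The lines after \<open>s\<close> lead to \<open>right_weight\<close> in the same
  way.\<close>

definition left_weight :: "nat \<Rightarrow> nat \<Rightarrow> nat \<Rightarrow> (nat \<Rightarrow> real) \<Rightarrow> real" where
  "left_weight p q s x =
     (if x \<in> ordered_points (num_particles p q s)
      then vandermonde (num_particles p q s) x * (\<Prod>i\<in>{1..num_particles p q s}. (1 - x i) ^ (s - q) * x i ^ (s - p))
      else 0)"

definition right_weight :: "nat \<Rightarrow> nat \<Rightarrow> nat \<Rightarrow> (nat \<Rightarrow> real) \<Rightarrow> real" where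
  "right_weight p q s x =
     (if x \<in> ordered_points (num_particles p q s)
      then vandermonde (num_particles p q s) x * (\<Prod>i\<in>{1..num_particles p q s}. (1 - x i) ^ (q - s) * x i ^ (p - s))
      else 0)"

lemma padded_next_decreasing:
  assumes "p \<le> q" "s < p + q" and z: "z \<in> ordered_points (num_particles p q (Suc s))"
    and "1 \<le> i" "i < j" "j \<le> Suc (num_particles p q s)"
  shows "padded_next p q s z j < padded_next p q s z i"
  using \<open>p \<le> q\<close>
proof (cases rule: step_cases[of p q s])
  case low
  with assms ordered_pointsD[OF z] show ?thesis by (auto simp: padded_next_def)
next
  case mid
  with assms ordered_pointsD[OF z] show ?thesis by (auto simp: padded_next_def)
next
  case high
  with assms ordered_pointsD(1,2)[OF z] ordered_pointsD(3)[OF z, of "i - 1" "j - 1"] show ?thesis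
    by (auto simp: padded_next_def)
qed

lemma padded_next_bounds:
  assumes "p \<le> q" "s < p + q" "1 \<le> s" and z: "z \<in> ordered_points (num_particles p q (Suc s))"
    and "1 \<le> i" "i \<le> Suc (num_particles p q s)"
  shows "0 \<le> padded_next p q s z i" "padded_next p q s z i \<le> 1"
proof -
  have "0 \<le> padded_next p q s z i \<and> padded_next p q s z i \<le> 1"
    using \<open>p \<le> q\<close>
  proof (cases rule: step_cases[of p q s])
    case low
    with assms ordered_pointsD(1,2)[OF z, of i] show ?thesis by (auto simp: padded_next_def)
  next
    case mid
    with assms ordered_pointsD(1,2)[OF z, of i] show ?thesis by (auto simp: padded_next_def)
  next
    case high
    then have "0 < z (i - 1) \<and> z (i - 1) < 1" if "i \<noteq> 1" "i \<noteq> Suc (p + q - s)"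
    proof -
      have "1 \<le> i - 1" "i - 1 \<le> num_particles p q (Suc s)" using that high assms by linarith+
      then show ?thesis using ordered_pointsD(1,2)[OF z] by blast
    qed
    with high show ?thesis
      by (auto simp: padded_next_def intro: less_imp_le)
  qed
  then show "0 \<le> padded_next p q s z i" "padded_next p q s z i \<le> 1" by auto
qed

lemma padded_prev_decreasing:
  assumes "p \<le> q" "s < p + q" and y: "y \<in> ordered_points (num_particles p q s)"
    and "i < j" "j \<le> num_particles p q (Suc s)"
  shows "padded_prev p q s y j < padded_prev p q s y i"
  using \<open>p \<le> q\<close>
proof (cases rule: step_cases[of p q s])
  case low
  with assms ordered_pointsD[OF y] show ?thesis by (auto simp: padded_prev_def)
next
  case mid
  with assms ordered_pointsD[OF y] show ?thesis by (auto simp: padded_prev_def)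
next
  case high
  with assms ordered_pointsD[OF y] show ?thesis by (auto simp: padded_prev_def)
qed

lemma padded_prev_bounds:
  assumes "p \<le> q" "s < p + q" "1 \<le> s" and y: "y \<in> ordered_points (num_particles p q s)"
    and "i \<le> num_particles p q (Suc s)"
  shows "0 \<le> padded_prev p q s y i" "padded_prev p q s y i \<le> 1"
proof -
  have "0 \<le> padded_prev p q s y i \<and> padded_prev p q s y i \<le> 1"
    using \<open>p \<le> q\<close>
  proof (cases rule: step_cases[of p q s])
    case low
    with assms ordered_pointsD(1,2)[OF y, of i] show ?thesis by (auto simp: padded_prev_def)
  next
    case mid
    with assms ordered_pointsD(1,2)[OF y, of i] show ?thesis by (auto simp: padded_prev_def)
  next
    case high
    have "1 \<le> Suc i" "Suc i \<le> num_particles p q s" using high assms by linarith+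
    then have "0 < y (Suc i) \<and> y (Suc i) < 1" using ordered_pointsD(1,2)[OF y] by blast
    with high show ?thesis
      by (auto simp: padded_prev_def)
  qed
  then show "0 \<le> padded_prev p q s y i" "padded_prev p q s y i \<le> 1" by auto
qed

text \<open>For fixed \<open>z\<close> the points \<open>y\<close> lie in successive gaps of a
  decreasing sequence in the unit interval. \<open>padded_next\<close> counts from 1 and
  \<open>ordered_points_between\<close> from 0, whence the shift to \<open>Suc i\<close>.\<close>

lemma step_interlacing_imp_ordered:
  assumes "p \<le> q" "1 \<le> s" "s < p + q" and z: "z \<in> ordered_points (num_particles p q (Suc s))"
    and "step_interlacing p q s y z"
  shows "y \<in> ordered_points (num_particles p q s)"
proof (rule ordered_points_between[where a = "\<lambda>i. padded_next p q s z (Suc i)"])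
  fix i assume "i \<in> {1..num_particles p q s}"
  then show "padded_next p q s z (Suc i) < y i \<and> y i < padded_next p q s z (Suc (i - 1))"
    using assms(5) by (auto simp: step_interlacing_def)
qed (use assms padded_next_decreasing padded_next_bounds in auto)

text \<open>The same inequalities, grouped around the points of line \<open>s + 1\<close> instead of
  those of line \<open>s\<close>. Inequalities with an added 0 or 1 hold because all points lie in
  the unit interval, so they may appear in one grouping and be absent from the other.\<close>

lemma step_interlacing_iff_padded_prev:
  assumes pq: "p \<le> q" "1 \<le> s" "s < p + q" and y: "y \<in> ordered_points (num_particles p q s)"
  shows "z \<in> ordered_points (num_particles p q (Suc s)) \<and> step_interlacing p q s y z \<longleftrightarrow>
    (\<forall>i\<in>{1..num_particles p q (Suc s)}. padded_prev p q s y i < z i \<and> z i < padded_prev p q s y (i - 1))"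
    (is "?L \<longleftrightarrow> ?R")
proof -
  have R: "z \<in> ordered_points (num_particles p q (Suc s))" if ?R
    by (rule ordered_points_between[where a = "padded_prev p q s y"])
       (use that assms padded_prev_decreasing padded_prev_bounds in auto)
  have "step_interlacing p q s y z \<longleftrightarrow> ?R" if z: "z \<in> ordered_points (num_particles p q (Suc s))"
    using \<open>p \<le> q\<close>
  proof (cases rule: step_cases[of p q s])
    case low
    show ?thesis
    proof
      assume L: "step_interlacing p q s y z"
      have "padded_prev p q s y i < z i \<and> z i < padded_prev p q s y (i - 1)" if "i \<in> {1..Suc s}" for i
      proof -
        have "y i < z i" if "i \<noteq> Suc s" using L \<open>i \<in> _\<close> that low by (auto simp: step_interlacing_def padded_next_def)
        \<comment> \<open>The upper bound on \<open>z i\<close> comes from the inequality for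
          particle \<open>i - 1\<close> of line \<open>s\<close>; for \<open>i = 1\<close> it is the
          added point 1.\<close>
        moreover have "z i < y (i - 1)" if "i \<noteq> 1"
          using L[unfolded step_interlacing_def, rule_format, of "i - 1"] \<open>i \<in> _\<close> that low by (cases i) (auto simp: padded_next_def)
        ultimately show ?thesis
          using that low ordered_pointsD(1,2)[OF z, of i] by (auto simp: padded_prev_def)
      qed
      then show ?R using low by simp
    next
      assume R: ?R
      show "step_interlacing p q s y z"
        unfolding step_interlacing_def
      proof
        fix i assume i: "i \<in> {1..num_particles p q s}"
        then show "padded_next p q s z (Suc i) < y i \<and> y i < padded_next p q s z i"
          using bspec[OF R, of i] bspec[OF R, of "Suc i"] low by (auto simp: padded_next_def padded_prev_def)
      qed
    qed
  next
    case mid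
    show ?thesis
    proof
      assume L: "step_interlacing p q s y z"
      have "padded_prev p q s y i < z i \<and> z i < padded_prev p q s y (i - 1)" if "i \<in> {1..p}" for i
      proof -
        have "y i < z i" using L that mid by (auto simp: step_interlacing_def padded_next_def)
        moreover have "z i < y (i - 1)" if "i \<noteq> 1"
          using L[unfolded step_interlacing_def, rule_format, of "i - 1"] \<open>i \<in> _\<close> that mid by (cases i) (auto simp: padded_next_def)
        ultimately show ?thesis
          using that mid ordered_pointsD(1,2)[OF z, of i] by (auto simp: padded_prev_def)
      qed
      then show ?R using mid by simp
    next
      assume R: ?R
      show "step_interlacing p q s y z"
        unfolding step_interlacing_def
      proof
        fix i assume i: "i \<in> {1..num_particles p q s}"
        then show "padded_next p q s z (Suc i) < y i \<and> y i < padded_next p q s z i"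
          using bspec[OF R, of i] bspec[OF R, of "Suc i"] mid ordered_pointsD(1)[OF y, of i]
          by (auto simp: padded_next_def padded_prev_def)
      qed
    qed
  next
    case high
    show ?thesis
    proof
      assume L: "step_interlacing p q s y z"
      have "padded_prev p q s y i < z i \<and> z i < padded_prev p q s y (i - 1)" if "i \<in> {1..p + q - Suc s}" for i
      proof -
        have "i \<in> {1..num_particles p q s}" "Suc i \<in> {1..num_particles p q s}" "Suc i \<noteq> Suc (p + q - s)"
          using that high by auto
        then show ?thesis
          using L[unfolded step_interlacing_def, rule_format, of i] L[unfolded step_interlacing_def, rule_format, of "Suc i"] that high
          by (auto simp: padded_next_def padded_prev_def)
      qed
      then show ?R using high by simp
    next
      assume R: ?R
      show "step_interlacing p q s y z"
        unfolding step_interlacing_def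
      proof
        fix i assume i: "i \<in> {1..num_particles p q s}"
        \<comment> \<open>Slot \<open>i\<close> of \<open>padded_next\<close> now holds
          \<open>z (i - 1)\<close>, because slot 1 is taken by the added point 1. The first and the
          last particle have 1 and 0 as outer bounds.\<close>
        have "y i < z (i - 1)" if "i \<noteq> 1"
        proof -
          have "i - 1 \<in> {1..num_particles p q (Suc s)}" "Suc (i - 1) = i" using that i high by auto
          with bspec[OF R, of "i - 1"] high show ?thesis by (simp add: padded_prev_def)
        qed
        moreover have "z i < y i" if "i \<noteq> p + q - s"
        proof -
          have "i \<in> {1..num_particles p q (Suc s)}" "Suc (i - 1) = i" using that i high by auto
          with bspec[OF R, of i] high show ?thesis by (simp add: padded_prev_def)
        qed
        ultimately show "padded_next p q s z (Suc i) < y i \<and> y i < padded_next p q s z i"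
          using i high ordered_pointsD(1,2)[OF y, of i] by (auto simp: padded_next_def)
      qed
    qed
  qed
  then show ?thesis using R by blast
qed

section \<open>The value of the interlacing integral in terms of the weights\<close>

lemma vandermonde_insert_ends:
  "vandermonde m (\<lambda>i. x (Suc i)) * (\<Prod>i\<in>{1..m}. (x 1 - x (Suc i)) * (x (Suc i) - x (Suc (Suc m)))) * (x 1 - x (Suc (Suc m)))
    = vandermonde (Suc (Suc m)) x"
  by (subst vandermonde_Suc, subst vandermonde_Suc_shift, subst prod_atLeast1_atMost_Suc_shift)
     (simp add: prod.distrib)

text \<open>An end of the sequence \<open>a\<close> that is a point of \<open>z\<close> completes
  the Vandermonde product; an end that was added raises an exponent. On growing lines both ends are
  points (\<open>vandermonde_insert_ends\<close>), on the middle lines the lower end is 0, and on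
  shrinking lines the ends are 1 and 0.\<close>

lemma left_weight_Suc:
  assumes pq: "1 \<le> p" "p \<le> q" "1 \<le> s" "Suc s < p + q" and m: "num_particles p q s = Suc m"
    and z: "z \<in> ordered_points (num_particles p q (Suc s))"
    and a: "a = (\<lambda>i. padded_next p q s z (Suc i))"
  shows "vandermonde m a * (\<Prod>i\<in>{1..m}. (a 0 - a i) ^ Suc (s - q) * (a i - a (Suc m)) ^ Suc (s - p))
      * (a 0 - a (Suc m)) ^ Suc ((s - p) + (s - q)) = left_weight p q (Suc s) z"
  using \<open>p \<le> q\<close>
proof (cases rule: step_cases[of p q s])
  case low
  then have "a = (\<lambda>i. z (Suc i))" "s = Suc m" "s - p = 0" "s - q = 0" "Suc s - p = 0" "Suc s - q = 0"
    using m pq by (auto simp: a padded_next_def fun_eq_iff)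
  then show ?thesis
    using vandermonde_insert_ends[of m z] low z by (simp add: left_weight_def)
next
  case mid
  then have [simp]: "p = Suc m" "s - q = 0" "Suc s - q = 0" using m by auto
  have a': "a i = z (Suc i)" if "i \<le> m" for i
    using that mid by (auto simp: a padded_next_def)
  have [simp]: "a (Suc m) = 0" "a 0 = z 1" using mid a'[of 0] by (auto simp: a padded_next_def)
  have "vandermonde m a = vandermonde m (\<lambda>i. z (Suc i))"
    by (rule vandermonde_cong) (use a' in auto)
  moreover have "(\<Prod>i\<in>{1..m}. (a 0 - a i) ^ Suc (s - q) * (a i - a (Suc m)) ^ Suc (s - p)) =
    (\<Prod>i\<in>{1..m}. (z 1 - z (Suc i)) * z (Suc i) ^ Suc (s - p))"
    by (rule prod.cong) (use a' in auto)
  moreover have "(\<Prod>i\<in>{1..Suc m}. z i ^ Suc (s - p)) = z 1 ^ Suc (s - p) * (\<Prod>i\<in>{1..m}. z (Suc i) ^ Suc (s - p))"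
    by (rule prod_atLeast1_atMost_Suc_shift)
  moreover have "Suc s - p = Suc (s - p)" using mid by simp
  ultimately show ?thesis
    using mid z by (simp add: left_weight_def vandermonde_Suc_shift[of m] prod.distrib del: prod.cl_ivl_Suc power_Suc)
next
  case high
  then have n: "p + q - s = Suc m" "p + q - Suc s = m" using m by auto
  have a': "a i = z i" if "i \<in> {1..m}" for i
    using that high n by (auto simp: a padded_next_def)
  have [simp]: "a (Suc m) = 0" "a 0 = 1" using high n by (auto simp: a padded_next_def)
  have "vandermonde m a = vandermonde m z"
    by (rule vandermonde_cong) (use a' in auto)
  moreover have "(\<Prod>i\<in>{1..m}. (a 0 - a i) ^ Suc (s - q) * (a i - a (Suc m)) ^ Suc (s - p)) =
    (\<Prod>i\<in>{1..m}. (1 - z i) ^ (Suc s - q) * z i ^ (Suc s - p))"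
    by (rule prod.cong) (use a' high in \<open>auto simp: Suc_diff_le\<close>)
  ultimately show ?thesis
    using high n z by (simp add: left_weight_def del: power_Suc)
qed

text \<open>The mirror image: the ends are now 1 and 0 on growing lines, only the upper end 1 is
  added on the middle lines, and none is added on shrinking ones. The raised exponents are those
  that grow from \<open>q - Suc s\<close> to \<open>q - s\<close> and from \<open>p - Suc s\<close>
  to \<open>p - s\<close>.\<close>

lemma right_weight_Suc:
  assumes pq: "1 \<le> p" "p \<le> q" "1 \<le> s" "Suc s < p + q" and m: "num_particles p q (Suc s) = Suc m"
    and y: "y \<in> ordered_points (num_particles p q s)"
    and a: "a = padded_prev p q s y"
  shows "vandermonde m a * (\<Prod>i\<in>{1..m}. (a 0 - a i) ^ Suc (q - Suc s) * (a i - a (Suc m)) ^ Suc (p - Suc s))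
      * (a 0 - a (Suc m)) ^ Suc ((p - Suc s) + (q - Suc s)) = right_weight p q s y"
  using \<open>p \<le> q\<close>
proof (cases rule: step_cases[of p q s])
  case low
  then have [simp]: "s = m" using m by simp
  have a': "a i = y i" if "i \<in> {1..m}" for i
    using that low by (auto simp: a padded_prev_def)
  have [simp]: "a (Suc m) = 0" "a 0 = 1" using low by (auto simp: a padded_prev_def)
  have "vandermonde m a = vandermonde m y"
    by (rule vandermonde_cong) (use a' in auto)
  moreover have "(\<Prod>i\<in>{1..m}. (a 0 - a i) ^ Suc (q - Suc s) * (a i - a (Suc m)) ^ Suc (p - Suc s)) =
    (\<Prod>i\<in>{1..m}. (1 - y i) ^ (q - s) * y i ^ (p - s))"
    by (rule prod.cong) (use a' low pq in \<open>auto simp: Suc_diff_Suc\<close>)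
  ultimately show ?thesis
    using low y by (simp add: right_weight_def del: power_Suc)
next
  case mid
  then have [simp]: "p = Suc m" "p - s = 0" "p - Suc s = 0" using m by auto
  have a': "a i = y i" if "i \<in> {1..Suc m}" for i
    using that mid by (auto simp: a padded_prev_def)
  have [simp]: "a (Suc m) = y (Suc m)" "a 0 = 1" using mid a'[of "Suc m"] by (auto simp: a padded_prev_def)
  have "vandermonde m a = vandermonde m y"
    by (rule vandermonde_cong) (use a' in auto)
  moreover have "(\<Prod>i\<in>{1..m}. (a 0 - a i) ^ Suc (q - Suc s) * (a i - a (Suc m)) ^ Suc (p - Suc s)) =
    (\<Prod>i\<in>{1..m}. (1 - y i) ^ (q - s) * (y i - y (Suc m)))"
    by (rule prod.cong) (use a' mid in \<open>auto simp: Suc_diff_Suc\<close>)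
  moreover have "Suc (q - Suc s) = q - s" using mid by simp
  ultimately show ?thesis
    using mid y by (simp add: right_weight_def vandermonde_Suc[of m] prod.distrib mult_ac del: power_Suc)
next
  case high
  then have n: "p + q - s = Suc (Suc m)" using m by auto
  have "a = (\<lambda>i. y (Suc i))" "p - s = 0" "q - s = 0" "p - Suc s = 0" "q - Suc s = 0"
    using high by (auto simp: a padded_prev_def fun_eq_iff)
  then show ?thesis
    using vandermonde_insert_ends[of m y] high n y by (simp add: right_weight_def)
qed

section \<open>The joint density as a product of step kernels\<close>

lemma rev_sorted_list_of_set_image_decreasing:
  fixes x :: "nat \<Rightarrow> 'a::linorder"
  assumes "\<And>i j. 1 \<le> i \<Longrightarrow> i < j \<Longrightarrow> j \<le> m \<Longrightarrow> x j < x i"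
  shows "rev (sorted_list_of_set (x ` {1..m})) = map x [1..<Suc m]"
proof -
  let ?xs = "map x [1..<Suc m]"
  have "sorted_wrt (>) ?xs"
    using assms by (auto simp: sorted_wrt_iff_nth_less simp del: upt_Suc)
  then have "sorted_wrt (<) (rev ?xs)"
    by (simp only: sorted_wrt_rev)
  moreover have "sorted_wrt (<) (sorted_list_of_set (x ` {1..m}))"
    by (rule strict_sorted_list_of_set)
  moreover have "set (rev ?xs) = set (sorted_list_of_set (x ` {1..m}))"
    by (auto simp del: upt_Suc)
  ultimately have "rev ?xs = sorted_list_of_set (x ` {1..m})"
    using strict_sorted_equal by metis
  then show ?thesis by (metis rev_rev_ident)
qed

text \<open>Decreasing enumerations are injective, so the cardinalities fit, and the reversed sorted
  lists are the enumerations themselves, shifted to start at 0.\<close>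

lemma interlace_chi_image:
  assumes y: "\<And>i j. 1 \<le> i \<Longrightarrow> i < j \<Longrightarrow> j \<le> m \<Longrightarrow> y j < y i"
    and z: "\<And>i j. 1 \<le> i \<Longrightarrow> i < j \<Longrightarrow> j \<le> Suc m \<Longrightarrow> z j < z i"
  shows "interlace_chi (y ` {1..m}) (z ` {1..Suc m}) = of_bool (\<forall>i\<in>{1..m}. z (Suc i) < y i \<and> y i < z i)"
proof -
  have inj: "inj_on y {1..m}" "inj_on z {1..Suc m}"
    using y z by (auto intro!: linorder_inj_onI' simp: less_imp_neq[THEN not_sym])
  have "card (y ` {1..m}) = m" "card (z ` {1..Suc m}) = Suc m"
    using card_image[OF inj(1)] card_image[OF inj(2)] by simp_all
  moreover have "(\<forall>i\<in>{1..m}. P i) \<longleftrightarrow> (\<forall>i<m. P (Suc i))" for P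
    by (subst image_Suc_lessThan[symmetric]) auto
  moreover have "rev (sorted_list_of_set (y ` {1..m})) = map y [1..<Suc m]"
    by (rule rev_sorted_list_of_set_image_decreasing) (rule y)
  moreover have "rev (sorted_list_of_set (z ` {1..Suc m})) = map z [1..<Suc (Suc m)]"
    by (rule rev_sorted_list_of_set_image_decreasing) (rule z)
  ultimately show ?thesis
    by (simp add: interlace_chi_def del: upt_Suc)
qed

text \<open>One conditional covers the three kinds of factors of the density. The case
  \<open>s = p + q - 1\<close> is included: line \<open>p + q\<close> is empty and only the points 1
  and 0 remain.\<close>

lemma line_set_Suc_padded:
  assumes "1 \<le> p" "p \<le> q" "1 \<le> s" "s < p + q"
  shows "line_set p q x (s + 1) \<union> (if s < p then {} else if s < q then {0} else {0, 1}) =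
    padded_next p q s (x (Suc s)) ` {1..Suc (num_particles p q s)}"
  using \<open>p \<le> q\<close>
proof (cases rule: step_cases[of p q s])
  case low
  then show ?thesis by (simp add: line_set_def padded_next_def)
next
  case mid
  have "padded_next p q s (x (Suc s)) ` {1..p} = x (Suc s) ` {1..p}"
    by (rule image_cong) (use mid in \<open>auto simp: padded_next_def\<close>)
  moreover have "padded_next p q s (x (Suc s)) (Suc p) = 0"
    using mid by (simp add: padded_next_def)
  moreover have "{1..Suc p} = insert (Suc p) {1..p}" by auto
  ultimately have "padded_next p q s (x (Suc s)) ` {1..Suc p} = insert 0 (x (Suc s) ` {1..p})"
    by (simp only: image_insert)
  then show ?thesis
    using mid by (simp add: line_set_def)
next
  case high
  define n where "n = p + q - Suc s"
  have n: "p + q - s = Suc n" using assms by (simp add: n_def)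
  \<comment> \<open>The \<open>n\<close> particles of line \<open>s + 1\<close> occupy slots 2 to
    \<open>n + 1\<close>; slots 1 and \<open>n + 2\<close> hold the points 1 and 0.\<close>
  have "{1..Suc (Suc n)} = insert 1 (insert (Suc (Suc n)) (Suc ` {1..n}))"
    by (simp only: image_Suc_atLeastAtMost) auto
  moreover have "padded_next p q s (x (Suc s)) ` Suc ` {1..n} = x (Suc s) ` {1..n}"
    unfolding image_image by (rule image_cong) (use high n in \<open>auto simp: padded_next_def\<close>)
  moreover have "padded_next p q s (x (Suc s)) 1 = 1" "padded_next p q s (x (Suc s)) (Suc (Suc n)) = 0"
    using high n by (auto simp: padded_next_def)
  ultimately have "padded_next p q s (x (Suc s)) ` {1..Suc (Suc n)} = insert 1 (insert 0 (x (Suc s) ` {1..n}))"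
    by (simp only: image_insert)
  then show ?thesis
    using high n by (simp add: line_set_def insert_commute flip: n_def)
qed

lemma interlace_chi_line_set:
  assumes "1 \<le> p" "p \<le> q" "1 \<le> s" "s < p + q"
    and y: "x s \<in> ordered_points (num_particles p q s)"
    and z: "x (Suc s) \<in> ordered_points (num_particles p q (Suc s))"
  shows "interlace_chi (line_set p q x s) (line_set p q x (s + 1) \<union> (if s < p then {} else if s < q then {0} else {0, 1})) =
    of_bool (step_interlacing p q s (x s) (x (Suc s)))"
  unfolding line_set_Suc_padded[OF assms(1-4)] line_set_def[of _ _ _ s] step_interlacing_def
  by (rule interlace_chi_image) (use ordered_pointsD(3)[OF y] padded_next_decreasing[OF assms(2,4) z] in auto)

text \<open>Gives the weight the shape of a chain with boundary functions. On ordered configurations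
  both boundary weights equal 1, since the first and the last line carry one particle and all
  exponents truncate to 0.\<close>

lemma bead_weight_eq:
  assumes pq: "1 \<le> p" "p \<le> q"
  shows "bead_weight p q x = left_weight p q 1 (x 1) *
    (\<Prod>s\<in>{1..<p + q - 1}. step_kernel p q s (x s) (x (Suc s))) * right_weight p q (p + q - 1) (x (p + q - 1))"
proof (cases "\<forall>t\<in>{1..p + q - 1}. x t \<in> ordered_points (num_particles p q t)")
  case True
  let ?N = "p + q - 1"
  let ?F = "\<lambda>s. of_bool (step_interlacing p q s (x s) (x (Suc s))) :: real"
  have ord: "x s \<in> ordered_points (num_particles p q s)" if "1 \<le> s" "s \<le> p + q" for s
  proof (cases "s = p + q")
    case True
    then show ?thesis using pq by (simp add: num_particles_high ordered_points_def)
  next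
    case False
    then have "s \<in> {1..?N}" using that by auto
    then show ?thesis using True by blast
  qed
  have chi: "interlace_chi (line_set p q x s) (line_set p q x (s + 1) \<union> (if s < p then {} else if s < q then {0} else {0, 1})) = ?F s"
    if "1 \<le> s" "s < p + q" for s
    using interlace_chi_line_set[OF pq that] ord that by simp
  have "bead_weight p q x = (\<Prod>s\<in>{1..<p}. ?F s) * (\<Prod>s\<in>{p..<q}. ?F s) * (\<Prod>s\<in>{q..?N}. ?F s)"
  proof -
    have "(\<Prod>s\<in>{1..<p}. interlace_chi (line_set p q x s) (line_set p q x (s + 1))) = (\<Prod>s\<in>{1..<p}. ?F s)"
    proof (rule prod.cong)
      fix s assume "s \<in> {1..<p}"
      then show "interlace_chi (line_set p q x s) (line_set p q x (s + 1)) = ?F s" using chi[of s] pq by simp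
    qed simp
    moreover have "(\<Prod>s\<in>{p..<q}. interlace_chi (line_set p q x s) (line_set p q x (s + 1) \<union> {0})) = (\<Prod>s\<in>{p..<q}. ?F s)"
    proof (rule prod.cong)
      fix s assume "s \<in> {p..<q}"
      then show "interlace_chi (line_set p q x s) (line_set p q x (s + 1) \<union> {0}) = ?F s" using chi[of s] pq by simp
    qed simp
    moreover have "(\<Prod>s\<in>{q..?N}. interlace_chi (line_set p q x s) (line_set p q x (s + 1) \<union> {0, 1})) = (\<Prod>s\<in>{q..?N}. ?F s)"
    proof (rule prod.cong)
      fix s assume "s \<in> {q..?N}"
      then have "1 \<le> s" "s < p + q" "\<not> s < p" "\<not> s < q" using pq by auto
      then show "interlace_chi (line_set p q x s) (line_set p q x (s + 1) \<union> {0, 1}) = ?F s" using chi[of s] by simp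
    qed simp
    ultimately show ?thesis
      by (simp only: bead_weight_def if_P[OF True])
  qed
  also have "\<dots> = (\<Prod>s\<in>{1..<Suc ?N}. ?F s)"
  proof -
    have "{q..?N} = {q..<Suc ?N}" by auto
    moreover have "(\<Prod>s\<in>{1..<p}. ?F s) * (\<Prod>s\<in>{p..<q}. ?F s) = (\<Prod>s\<in>{1..<q}. ?F s)"
      by (rule prod.atLeastLessThan_concat) (use pq in auto)
    moreover have "(\<Prod>s\<in>{1..<q}. ?F s) * (\<Prod>s\<in>{q..<Suc ?N}. ?F s) = (\<Prod>s\<in>{1..<Suc ?N}. ?F s)"
      by (rule prod.atLeastLessThan_concat) (use pq in auto)
    ultimately show ?thesis by (simp only:)
  qed
  also have "\<dots> = (\<Prod>s\<in>{1..<?N}. ?F s) * ?F ?N"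
    using pq by (subst prod.atLeastLessThan_Suc) auto
  \<comment> \<open>The single particle of the last line only has to lie between the added points 0
    and 1.\<close>
  also have "?F ?N = 1"
  proof -
    have n: "num_particles p q ?N = 1" "p + q - ?N = 1" "\<not> ?N < p" "\<not> ?N < q"
      using pq by (auto simp: num_particles_high)
    then have "0 < x ?N 1" "x ?N 1 < 1"
      using ordered_pointsD(1,2)[OF ord[of ?N], of 1] pq by auto
    then show ?thesis
      using n by (simp add: step_interlacing_def padded_next_def)
  qed
  also have "(\<Prod>s\<in>{1..<?N}. ?F s) = (\<Prod>s\<in>{1..<?N}. step_kernel p q s (x s) (x (Suc s)))"
    by (rule prod.cong) (auto simp: step_kernel_def ord)
  also have "left_weight p q 1 (x 1) = 1"
    using ord[of 1] pq by (simp add: left_weight_def num_particles_low vandermonde_def)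
  then have "(\<Prod>s\<in>{1..<?N}. step_kernel p q s (x s) (x (Suc s))) * 1 = left_weight p q 1 (x 1) * (\<Prod>s\<in>{1..<?N}. step_kernel p q s (x s) (x (Suc s))) * 1"
    by simp
  also have "1 = right_weight p q ?N (x ?N)"
    using ord[of ?N] pq by (simp add: right_weight_def num_particles_high vandermonde_def)
  finally show ?thesis .
next
  case False
  then obtain t where t: "t \<in> {1..p + q - 1}" "x t \<notin> ordered_points (num_particles p q t)" by blast
  have "bead_weight p q x = 0"
    using False by (simp only: bead_weight_def if_False)
  \<comment> \<open>A line that is not ordered annihilates the kernel starting from it. No kernel
    starts from the last line; there the right weight vanishes.\<close>
  moreover have "t = p + q - 1 \<or> t \<in> {1..<p + q - 1}" using t(1) by auto
  then have "(\<Prod>s\<in>{1..<p + q - 1}. step_kernel p q s (x s) (x (Suc s))) * right_weight p q (p + q - 1) (x (p + q - 1)) = 0"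
  proof
    assume "t = p + q - 1"
    then show ?thesis using t by (simp add: right_weight_def)
  next
    assume "t \<in> {1..<p + q - 1}"
    then have "(\<Prod>s\<in>{1..<p + q - 1}. step_kernel p q s (x s) (x (Suc s))) = 0"
      using t by (intro prod_zero bexI[of _ t]) (auto simp: step_kernel_def)
    then show ?thesis by (simp only: mult_zero_left)
  qed
  ultimately show ?thesis by (simp only: mult.assoc mult_zero_right)
qed

section \<open>One-step integrals of the weights\<close>

lemma step_kernel_nonneg: "0 \<le> step_kernel p q s y z"
  by (simp add: step_kernel_def)

text \<open>If \<open>z\<close> is not ordered, both sides vanish. Otherwise this is the interlacing
  integral over the gaps of \<open>padded_next\<close>, with exponents \<open>s - q\<close> and
  \<open>s - p\<close> and a constant independent of \<open>z\<close>.\<close>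

lemma nn_integral_left_weight_step:
  assumes pq: "1 \<le> p" "p \<le> q" "1 \<le> s" "Suc s < p + q"
  shows "\<exists>C>0. \<forall>z. (\<integral>\<^sup>+y. ennreal (left_weight p q s y) * ennreal (step_kernel p q s y z) \<partial>line_measure p q s) =
    ennreal C * ennreal (left_weight p q (Suc s) z)"
proof -
  have "num_particles p q s \<ge> 1"
    using pq by (auto simp: num_particles_def)
  then obtain m where m: "num_particles p q s = Suc m"
    by (cases "num_particles p q s") auto
  obtain C where "C > 0" and C: "\<And>a :: nat \<Rightarrow> real. (\<forall>i\<le>m. a (Suc i) < a i) \<Longrightarrow>
    (\<integral>\<^sup>+u. ennreal (if \<forall>i\<in>{1..Suc m}. a i < u i \<and> u i < a (i - 1)
        then vandermonde (Suc m) u * (\<Prod>i\<in>{1..Suc m}. (a 0 - u i) ^ (s - q) * (u i - a (Suc m)) ^ (s - p)) else 0)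
      \<partial>(\<Pi>\<^sub>M i\<in>{1..Suc m}. lborel)) =
    ennreal (C * (vandermonde m a * (\<Prod>i\<in>{1..m}. (a 0 - a i) ^ Suc (s - q) * (a i - a (Suc m)) ^ Suc (s - p))
      * (a 0 - a (Suc m)) ^ Suc ((s - p) + (s - q))))"
    using nn_integral_interlacing[of m "s - q" "s - p"] by blast
  have "(\<integral>\<^sup>+y. ennreal (left_weight p q s y) * ennreal (step_kernel p q s y z) \<partial>line_measure p q s) =
    ennreal C * ennreal (left_weight p q (Suc s) z)" for z
  proof (cases "z \<in> ordered_points (num_particles p q (Suc s))")
    case False
    then show ?thesis by (simp add: step_kernel_def left_weight_def)
  next
    case True
    define a where "a = (\<lambda>i. padded_next p q s z (Suc i))"
    have dec: "\<forall>i\<le>m. a (Suc i) < a i"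
      using padded_next_decreasing[OF pq(2) _ True] pq m by (auto simp: a_def)
    \<comment> \<open>The weight has base \<open>1 - t\<close>, the interlacing integral
      \<open>a 0 - t\<close>: either \<open>a 0\<close> is the added point 1 or the exponent is 0.
      The lower end is treated alike.\<close>
    have a0: "(a 0 - t) ^ (s - q) = (1 - t) ^ (s - q)" for t
      using pq by (cases "s \<le> q") (auto simp: a_def padded_next_def)
    have am: "(t - a (Suc m)) ^ (s - p) = t ^ (s - p)" for t
      using pq(2)
    proof (cases rule: step_cases[of p q s])
      case low then show ?thesis by simp
    qed (use m in \<open>auto simp: a_def padded_next_def\<close>)
    have "ennreal (left_weight p q s y) * ennreal (step_kernel p q s y z) =
      ennreal (if \<forall>i\<in>{1..Suc m}. a i < y i \<and> y i < a (i - 1)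
        then vandermonde (Suc m) y * (\<Prod>i\<in>{1..Suc m}. (a 0 - y i) ^ (s - q) * (y i - a (Suc m)) ^ (s - p)) else 0)" for y
    proof -
      have "step_interlacing p q s y z \<longleftrightarrow> (\<forall>i\<in>{1..Suc m}. a i < y i \<and> y i < a (i - 1))"
        unfolding step_interlacing_def m by (intro ball_cong) (auto simp: a_def)
      then have "y \<in> ordered_points (num_particles p q s) \<and> step_interlacing p q s y z \<longleftrightarrow>
          (\<forall>i\<in>{1..Suc m}. a i < y i \<and> y i < a (i - 1))"
        using step_interlacing_imp_ordered[OF pq(2,3) _ True] pq by auto
      moreover have "left_weight p q s y * step_kernel p q s y z =
          (if y \<in> ordered_points (num_particles p q s) \<and> step_interlacing p q s y z
           then vandermonde (Suc m) y * (\<Prod>i\<in>{1..Suc m}. (1 - y i) ^ (s - q) * y i ^ (s - p)) else 0)"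
        using True by (simp add: left_weight_def step_kernel_def m)
      ultimately have "left_weight p q s y * step_kernel p q s y z =
          (if \<forall>i\<in>{1..Suc m}. a i < y i \<and> y i < a (i - 1)
           then vandermonde (Suc m) y * (\<Prod>i\<in>{1..Suc m}. (a 0 - y i) ^ (s - q) * (y i - a (Suc m)) ^ (s - p)) else 0)"
        unfolding a0 am by (simp only:)
      then show ?thesis
        by (simp only: ennreal_mult''[OF step_kernel_nonneg, symmetric])
    qed
    then have "(\<integral>\<^sup>+y. ennreal (left_weight p q s y) * ennreal (step_kernel p q s y z) \<partial>line_measure p q s) =
      ennreal (C * left_weight p q (Suc s) z)"
      unfolding line_measure_def m by (simp only: C[OF dec] left_weight_Suc[OF pq m True a_def])
    then show ?thesis
      using \<open>C > 0\<close> by (simp add: ennreal_mult')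
  qed
  then show ?thesis using \<open>C > 0\<close> by blast
qed

text \<open>Here \<open>y\<close> is fixed and cuts out the gaps, through
  \<open>padded_prev\<close>; the exponents are those of line \<open>s + 1\<close>.\<close>

lemma nn_integral_right_weight_step:
  assumes pq: "1 \<le> p" "p \<le> q" "1 \<le> s" "Suc s < p + q"
  shows "\<exists>C>0. \<forall>y. (\<integral>\<^sup>+z. ennreal (step_kernel p q s y z) * ennreal (right_weight p q (Suc s) z) \<partial>line_measure p q (Suc s)) =
    ennreal C * ennreal (right_weight p q s y)"
proof -
  have "num_particles p q (Suc s) \<ge> 1"
    using pq by (auto simp: num_particles_def)
  then obtain m where m: "num_particles p q (Suc s) = Suc m"
    by (cases "num_particles p q (Suc s)") auto
  obtain C where "C > 0" and C: "\<And>a :: nat \<Rightarrow> real. (\<forall>i\<le>m. a (Suc i) < a i) \<Longrightarrow>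
    (\<integral>\<^sup>+u. ennreal (if \<forall>i\<in>{1..Suc m}. a i < u i \<and> u i < a (i - 1)
        then vandermonde (Suc m) u * (\<Prod>i\<in>{1..Suc m}. (a 0 - u i) ^ (q - Suc s) * (u i - a (Suc m)) ^ (p - Suc s)) else 0)
      \<partial>(\<Pi>\<^sub>M i\<in>{1..Suc m}. lborel)) =
    ennreal (C * (vandermonde m a * (\<Prod>i\<in>{1..m}. (a 0 - a i) ^ Suc (q - Suc s) * (a i - a (Suc m)) ^ Suc (p - Suc s))
      * (a 0 - a (Suc m)) ^ Suc ((p - Suc s) + (q - Suc s))))"
    using nn_integral_interlacing[of m "q - Suc s" "p - Suc s"] by blast
  have "(\<integral>\<^sup>+z. ennreal (step_kernel p q s y z) * ennreal (right_weight p q (Suc s) z) \<partial>line_measure p q (Suc s)) =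
    ennreal C * ennreal (right_weight p q s y)" for y
  proof (cases "y \<in> ordered_points (num_particles p q s)")
    case False
    then show ?thesis by (simp add: step_kernel_def right_weight_def)
  next
    case True
    define a where "a = padded_prev p q s y"
    have dec: "\<forall>i\<le>m. a (Suc i) < a i"
      using padded_prev_decreasing[OF pq(2) _ True] pq m by (auto simp: a_def)
    have a0: "(a 0 - t) ^ (q - Suc s) = (1 - t) ^ (q - Suc s)" for t
      using pq by (cases "s < q") (auto simp: a_def padded_prev_def)
    have am: "(t - a (Suc m)) ^ (p - Suc s) = t ^ (p - Suc s)" for t
      using pq m by (cases "s < p") (auto simp: a_def padded_prev_def num_particles_low)
    have "ennreal (step_kernel p q s y z) * ennreal (right_weight p q (Suc s) z) =
      ennreal (if \<forall>i\<in>{1..Suc m}. a i < z i \<and> z i < a (i - 1)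
        then vandermonde (Suc m) z * (\<Prod>i\<in>{1..Suc m}. (a 0 - z i) ^ (q - Suc s) * (z i - a (Suc m)) ^ (p - Suc s)) else 0)" for z
    proof -
      have "z \<in> ordered_points (num_particles p q (Suc s)) \<and> step_interlacing p q s y z \<longleftrightarrow>
          (\<forall>i\<in>{1..Suc m}. a i < z i \<and> z i < a (i - 1))"
        using step_interlacing_iff_padded_prev[OF pq(2,3) _ True, of z] pq unfolding a_def m by simp
      moreover have "step_kernel p q s y z * right_weight p q (Suc s) z =
          (if z \<in> ordered_points (num_particles p q (Suc s)) \<and> step_interlacing p q s y z
           then vandermonde (Suc m) z * (\<Prod>i\<in>{1..Suc m}. (1 - z i) ^ (q - Suc s) * z i ^ (p - Suc s)) else 0)"
        using True by (simp add: right_weight_def step_kernel_def m)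
      ultimately have "step_kernel p q s y z * right_weight p q (Suc s) z =
          (if \<forall>i\<in>{1..Suc m}. a i < z i \<and> z i < a (i - 1)
           then vandermonde (Suc m) z * (\<Prod>i\<in>{1..Suc m}. (a 0 - z i) ^ (q - Suc s) * (z i - a (Suc m)) ^ (p - Suc s)) else 0)"
        unfolding a0 am by (simp only:)
      then show ?thesis
        by (simp only: ennreal_mult'[OF step_kernel_nonneg, symmetric])
    qed
    then have "(\<integral>\<^sup>+z. ennreal (step_kernel p q s y z) * ennreal (right_weight p q (Suc s) z) \<partial>line_measure p q (Suc s)) =
      ennreal (C * right_weight p q s y)"
      unfolding line_measure_def m by (simp only: C[OF dec] right_weight_Suc[OF pq m True a_def])
    then show ?thesis
      using \<open>C > 0\<close> by (simp add: ennreal_mult')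
  qed
  then show ?thesis using \<open>C > 0\<close> by blast
qed

subsection \<open>Marginals\<close>

lemma pred_ordered_points [measurable]:
  "Measurable.pred (line_measure p q s) (\<lambda>x. x \<in> ordered_points (num_particles p q s))"
  unfolding ordered_points_def line_measure_def mem_Collect_eq
  by (intro pred_intros_logic pred_intros_finite) measurable

lemma borel_measurable_line_weight:
  fixes f :: "real \<Rightarrow> real"
  assumes [measurable]: "f \<in> borel_measurable borel"
  shows "(\<lambda>x. if x \<in> ordered_points (num_particles p q s)
      then vandermonde (num_particles p q s) x * (\<Prod>i\<in>{1..num_particles p q s}. f (x i)) else 0)
    \<in> borel_measurable (line_measure p q s)"
proof -
  have [measurable]: "(\<lambda>x. x i) \<in> borel_measurable (line_measure p q s)" if "i \<in> {1..num_particles p q s}" for i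
    using that measurable_component_singleton[of i "{1..num_particles p q s}" "\<lambda>_. lborel :: real measure"]
    by (simp add: line_measure_def)
  have [measurable]: "vandermonde (num_particles p q s) \<in> borel_measurable (line_measure p q s)"
    unfolding vandermonde_def by (intro borel_measurable_prod borel_measurable_diff) auto
  show ?thesis by measurable
qed

lemma borel_measurable_left_weight [measurable]:
  "left_weight p q s \<in> borel_measurable (line_measure p q s)"
  unfolding left_weight_def
  by (rule borel_measurable_line_weight[where f = "\<lambda>x. (1 - x) ^ (s - q) * x ^ (s - p)"]) measurable

lemma borel_measurable_right_weight [measurable]:
  "right_weight p q s \<in> borel_measurable (line_measure p q s)"
  unfolding right_weight_def
  by (rule borel_measurable_line_weight[where f = "\<lambda>x. (1 - x) ^ (q - s) * x ^ (p - s)"]) measurable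

lemma borel_measurable_step_kernel:
  assumes "p \<le> q" "s < p + q"
  shows "(\<lambda>(y, z). ennreal (step_kernel p q s y z)) \<in>
    borel_measurable (line_measure p q s \<Otimes>\<^sub>M line_measure p q (Suc s))"
proof -
  let ?M = "line_measure p q s \<Otimes>\<^sub>M line_measure p q (Suc s)"
  have comp: "(\<lambda>x. x i) \<in> borel_measurable (line_measure p q s)" if "i \<in> {1..num_particles p q s}" for i s
    using that measurable_component_singleton[of i "{1..num_particles p q s}" "\<lambda>_. lborel :: real measure"]
    by (simp add: line_measure_def)
  have y[measurable]: "(\<lambda>w. fst w i) \<in> borel_measurable ?M" if "i \<in> {1..num_particles p q s}" for i
    using measurable_compose[OF measurable_fst comp[OF that]] .
  have z: "(\<lambda>w. snd w i) \<in> borel_measurable ?M" if "i \<in> {1..num_particles p q (Suc s)}" for i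
    using measurable_compose[OF measurable_snd comp[OF that]] .
  have Z: "(\<lambda>w. padded_next p q s (snd w) i) \<in> borel_measurable ?M" if "i \<in> {1..Suc (num_particles p q s)}" for i
    using \<open>p \<le> q\<close>
  proof (cases rule: step_cases[of p q s])
    case low
    then show ?thesis using z[of i] that by (simp add: padded_next_def)
  next
    case mid
    then show ?thesis using z[of i] that by (cases "i = Suc p") (auto simp: padded_next_def)
  next
    case high
    have "(\<lambda>w. snd w (i - 1)) \<in> borel_measurable ?M" if "i \<noteq> 1" "i \<noteq> Suc (p + q - s)"
      by (rule z) (use that \<open>i \<in> _\<close> high in auto)
    with high show ?thesis
      by (cases "i = 1"; cases "i = Suc (p + q - s)") (auto simp: padded_next_def)
  qed
  have [measurable]: "Measurable.pred ?M (\<lambda>w. step_interlacing p q s (fst w) (snd w))"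
    unfolding step_interlacing_def
    by (intro pred_intros_finite pred_intros_logic borel_measurable_pred_less y Z) auto
  show ?thesis
    unfolding step_kernel_def case_prod_beta by measurable
qed

text \<open>With truncated subtraction, the absolute difference of \<open>q\<close> and
  \<open>t\<close> is \<open>(t - q) + (q - t)\<close>, where at least one summand is 0. So the left
  and right exponents add up to those of \<open>line_weight\<close>, and the two Vandermonde
  products give the square.\<close>

lemma line_pdf_eq_weights:
  "line_pdf p q t Z x = inverse Z * (left_weight p q t x * right_weight p q t x)"
proof -
  have "nat \<bar>int q - int t\<bar> = (t - q) + (q - t)" "nat \<bar>int p - int t\<bar> = (t - p) + (p - t)"
    by auto
  then show ?thesis
    by (simp add: left_weight_def right_weight_def line_pdf_def line_weight_def power_add
        prod.distrib power2_eq_square mult_ac)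
qed

lemma borel_measurable_line_pdf [measurable]:
  "line_pdf p q t Z \<in> borel_measurable (line_measure p q t)"
  unfolding line_pdf_eq_weights[abs_def] by measurable

lemma vandermonde_mult_prod_nonneg:
  assumes "x \<in> ordered_points n"
  shows "0 \<le> vandermonde n x * (\<Prod>i\<in>{1..n}. (1 - x i) ^ a * x i ^ b)"
proof (intro mult_nonneg_nonneg prod_nonneg ballI zero_le_power)
  show "0 \<le> vandermonde n x"
    by (rule less_imp_le[OF vandermonde_pos]) (rule ordered_pointsD(3)[OF assms])
  show "0 \<le> 1 - x i" "0 \<le> x i" if "i \<in> {1..n}" for i
    using ordered_pointsD(1,2)[OF assms, of i] that by auto
qed

lemma left_weight_nonneg: "0 \<le> left_weight p q s x"
  unfolding left_weight_def using vandermonde_mult_prod_nonneg by simp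

lemma right_weight_nonneg: "0 \<le> right_weight p q s x"
  unfolding right_weight_def using vandermonde_mult_prod_nonneg by simp

section \<open>Marginals and total mass of the unnormalized density\<close>

lemma product_sigma_finite_line_measure: "product_sigma_finite (line_measure p q)"
proof (rule product_sigma_finite.intro)
  fix s
  interpret product_sigma_finite "\<lambda>_::nat. lborel :: real measure" ..
  show "sigma_finite_measure (line_measure p q s)"
    unfolding line_measure_def by (rule sigma_finite) simp
qed

lemma bead_weight_nonneg:
  assumes "1 \<le> p" "p \<le> q"
  shows "0 \<le> bead_weight p q x"
  unfolding bead_weight_eq[OF assms]
  by (intro mult_nonneg_nonneg prod_nonneg ballI left_weight_nonneg right_weight_nonneg step_kernel_nonneg)

text \<open>The marginal in weak form. The test function 1 later yields the total mass, indicators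
  yield the law of \<open>x t\<close>.\<close>

lemma nn_integral_bead_weight:
  assumes pq: "1 \<le> p" "p \<le> q" and t: "t \<in> {1..p + q - 1}"
  shows "\<exists>c>0. \<forall>G\<in>borel_measurable (line_measure p q t).
    (\<integral>\<^sup>+x. ennreal (bead_weight p q x) * G (x t) \<partial>config_measure p q) =
    ennreal c * (\<integral>\<^sup>+y. ennreal (line_pdf p q t 1 y) * G y \<partial>line_measure p q t)"
proof -
  let ?N = "p + q - 1"
  have "\<forall>s\<in>{1..<?N}. \<exists>C>0. \<forall>z. (\<integral>\<^sup>+y. ennreal (left_weight p q s y) * ennreal (step_kernel p q s y z) \<partial>line_measure p q s) =
      ennreal C * ennreal (left_weight p q (Suc s) z)"
    by (intro ballI nn_integral_left_weight_step[OF pq]) auto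
  from bchoice[OF this] obtain C where C: "\<And>s. s \<in> {1..<?N} \<Longrightarrow> C s > 0"
    "\<And>s z. s \<in> {1..<?N} \<Longrightarrow> (\<integral>\<^sup>+y. ennreal (left_weight p q s y) * ennreal (step_kernel p q s y z) \<partial>line_measure p q s) =
      ennreal (C s) * ennreal (left_weight p q (Suc s) z)"
    by blast
  have "\<forall>s\<in>{1..<?N}. \<exists>D>0. \<forall>y. (\<integral>\<^sup>+z. ennreal (step_kernel p q s y z) * ennreal (right_weight p q (Suc s) z) \<partial>line_measure p q (Suc s)) =
      ennreal D * ennreal (right_weight p q s y)"
    by (intro ballI nn_integral_right_weight_step[OF pq]) auto
  from bchoice[OF this] obtain D where D: "\<And>s. s \<in> {1..<?N} \<Longrightarrow> D s > 0"
    "\<And>s y. s \<in> {1..<?N} \<Longrightarrow> (\<integral>\<^sup>+z. ennreal (step_kernel p q s y z) * ennreal (right_weight p q (Suc s) z) \<partial>line_measure p q (Suc s)) =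
      ennreal (D s) * ennreal (right_weight p q s y)"
    by blast
  \<comment> \<open>Lines before \<open>t\<close> contribute the constants of the left steps, lines
    after \<open>t\<close> those of the right steps.\<close>
  define c where "c = (\<Prod>s\<in>{1..<t}. C s) * (\<Prod>s\<in>{t..<?N}. D s)"
  have pos: "(\<Prod>s\<in>{1..<t}. C s) > 0" "(\<Prod>s\<in>{t..<?N}. D s) > 0"
    using t C(1) D(1) by (auto intro!: prod_pos)
  have "(\<integral>\<^sup>+x. ennreal (bead_weight p q x) * G (x t) \<partial>config_measure p q) =
    ennreal c * (\<integral>\<^sup>+y. ennreal (line_pdf p q t 1 y) * G y \<partial>line_measure p q t)"
    if G: "G \<in> borel_measurable (line_measure p q t)" for G
  proof -
    have "(\<integral>\<^sup>+x. ennreal (left_weight p q 1 (x 1)) * (\<Prod>s\<in>{1..<?N}. ennreal (step_kernel p q s (x s) (x (Suc s)))) *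
        ennreal (right_weight p q ?N (x ?N)) * G (x t) \<partial>PiM {1..?N} (line_measure p q)) =
      (\<Prod>s\<in>{1..<t}. ennreal (C s)) * (\<Prod>s\<in>{t..<?N}. ennreal (D s)) *
      (\<integral>\<^sup>+y. ennreal (left_weight p q t y) * ennreal (right_weight p q t y) * G y \<partial>line_measure p q t)"
    proof (rule nn_integral_PiM_chain[OF product_sigma_finite_line_measure,
          where K = "\<lambda>s y z. ennreal (step_kernel p q s y z)" and g = "\<lambda>s y. ennreal (left_weight p q s y)"
            and h = "\<lambda>s y. ennreal (right_weight p q s y)"])
      show "1 \<le> t" "t \<le> ?N" using t by auto
      show "(\<lambda>(y, z). ennreal (step_kernel p q s y z)) \<in> borel_measurable (line_measure p q s \<Otimes>\<^sub>M line_measure p q (Suc s))"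
        if "s < ?N" for s
        by (rule borel_measurable_step_kernel) (use pq that in auto)
    qed (use t C(2) D(2) G in auto)
    moreover have "ennreal (bead_weight p q x) = ennreal (left_weight p q 1 (x 1)) *
        (\<Prod>s\<in>{1..<?N}. ennreal (step_kernel p q s (x s) (x (Suc s)))) * ennreal (right_weight p q ?N (x ?N))" for x
      unfolding bead_weight_eq[OF pq]
      by (simp add: prod_ennreal step_kernel_nonneg ennreal_mult left_weight_nonneg right_weight_nonneg prod_nonneg)
    moreover have "ennreal (left_weight p q t y) * ennreal (right_weight p q t y) = ennreal (line_pdf p q t 1 y)" for y
      by (simp add: line_pdf_eq_weights left_weight_nonneg right_weight_nonneg ennreal_mult)
    moreover have "(\<Prod>s\<in>{1..<t}. ennreal (C s)) * (\<Prod>s\<in>{t..<?N}. ennreal (D s)) = ennreal c"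
    proof -
      have "(\<Prod>s\<in>{1..<t}. ennreal (C s)) = ennreal (\<Prod>s\<in>{1..<t}. C s)"
        using t by (intro prod_ennreal less_imp_le C(1)) auto
      moreover have "(\<Prod>s\<in>{t..<?N}. ennreal (D s)) = ennreal (\<Prod>s\<in>{t..<?N}. D s)"
        using t by (intro prod_ennreal less_imp_le D(1)) auto
      ultimately show ?thesis using pos by (simp add: c_def ennreal_mult)
    qed
    ultimately show ?thesis by (simp add: config_measure_def)
  qed
  moreover have "c > 0" using pos by (simp add: c_def)
  ultimately show ?thesis by blast
qed

lemma borel_measurable_bead_weight:
  assumes pq: "1 \<le> p" "p \<le> q"
  shows "bead_weight p q \<in> borel_measurable (config_measure p q)"
proof -
  let ?N = "p + q - 1"
  have comp: "(\<lambda>x. x s) \<in> config_measure p q \<rightarrow>\<^sub>M line_measure p q s" if "s \<in> {1..?N}" for s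
    unfolding config_measure_def using that by (rule measurable_component_singleton)
  \<comment> \<open>The kernel is known to be measurable with values in \<open>ennreal\<close>; as
    it is nonnegative, \<open>enn2real\<close> leads back to the reals.\<close>
  have "(\<lambda>x. enn2real (ennreal (step_kernel p q s (x s) (x (Suc s))))) \<in> borel_measurable (config_measure p q)"
    if "s \<in> {1..<?N}" for s
  proof -
    have "(\<lambda>x. (x s, x (Suc s))) \<in> config_measure p q \<rightarrow>\<^sub>M line_measure p q s \<Otimes>\<^sub>M line_measure p q (Suc s)"
      using that by (intro measurable_Pair comp) auto
    moreover have "s < p + q" using that by auto
    ultimately have "(\<lambda>x. (\<lambda>(y, z). ennreal (step_kernel p q s y z)) (x s, x (Suc s))) \<in> borel_measurable (config_measure p q)"
      by (rule measurable_compose[OF _ borel_measurable_step_kernel[OF pq(2)]])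
    then have "(\<lambda>x. ennreal (step_kernel p q s (x s) (x (Suc s)))) \<in> borel_measurable (config_measure p q)"
      by (simp only: prod.case)
    then show ?thesis by measurable
  qed
  then have K: "(\<lambda>x. step_kernel p q s (x s) (x (Suc s))) \<in> borel_measurable (config_measure p q)"
    if "s \<in> {1..<?N}" for s
    using that by (simp add: step_kernel_nonneg)
  have "1 \<in> {1..?N}" "?N \<in> {1..?N}" using pq by auto
  then have "(\<lambda>x. left_weight p q 1 (x 1)) \<in> borel_measurable (config_measure p q)"
    "(\<lambda>x. right_weight p q ?N (x ?N)) \<in> borel_measurable (config_measure p q)"
    using measurable_compose[OF comp borel_measurable_left_weight] measurable_compose[OF comp borel_measurable_right_weight] by blast+
  with K show ?thesis
    unfolding bead_weight_eq[OF pq, abs_def]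
    by (intro borel_measurable_times borel_measurable_prod) auto
qed

text \<open>The mass is computed on the last line. It carries one particle, so the integral there is
  a beta integral: the interlacing integral for \<open>m = 0\<close> with ends 1 and 0.\<close>

lemma nn_integral_bead_weight_total:
  assumes pq: "1 \<le> p" "p \<le> q"
  shows "\<exists>w>0. (\<integral>\<^sup>+x. ennreal (bead_weight p q x) \<partial>config_measure p q) = ennreal w"
proof -
  let ?N = "p + q - 1"
  let ?a = "\<lambda>i::nat. if i = 0 then 1 else 0 :: real"
  define l k where "l = nat \<bar>int q - int ?N\<bar>" and "k = nat \<bar>int p - int ?N\<bar>"
  have N: "num_particles p q ?N = Suc 0" using pq by (simp add: num_particles_high)
  obtain C where "C > 0" and C': "\<And>a :: nat \<Rightarrow> real. (\<forall>i\<le>0. a (Suc i) < a i) \<Longrightarrow>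
    (\<integral>\<^sup>+u. ennreal (if \<forall>i\<in>{1..Suc 0}. a i < u i \<and> u i < a (i - 1)
        then vandermonde (Suc 0) u * (\<Prod>i\<in>{1..Suc 0}. (a 0 - u i) ^ l * (u i - a (Suc 0)) ^ k) else 0)
      \<partial>(\<Pi>\<^sub>M i\<in>{1..Suc 0}. lborel)) =
    ennreal (C * (vandermonde 0 a * (\<Prod>i\<in>{1..0}. (a 0 - a i) ^ Suc l * (a i - a (Suc 0)) ^ Suc k)
      * (a 0 - a (Suc 0)) ^ Suc (k + l)))"
    using nn_integral_interlacing[of 0 l k] by blast
  have "\<forall>i\<le>0. ?a (Suc i) < ?a i" by simp
  note C = C'[OF this]
  have "ennreal (line_pdf p q ?N 1 u) = ennreal (if \<forall>i\<in>{1..Suc 0}. ?a i < u i \<and> u i < ?a (i - 1)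
        then vandermonde (Suc 0) u * (\<Prod>i\<in>{1..Suc 0}. (?a 0 - u i) ^ l * (u i - ?a (Suc 0)) ^ k) else 0)" for u
    unfolding line_pdf_def N line_weight_def l_def[symmetric] k_def[symmetric]
    by (simp add: ordered_points_def vandermonde_def)
  then have total: "(\<integral>\<^sup>+u. ennreal (line_pdf p q ?N 1 u) \<partial>line_measure p q ?N) = ennreal C"
    unfolding line_measure_def N by (simp only: C) simp
  have "?N \<in> {1..?N}" using pq by auto
  from nn_integral_bead_weight[OF pq this] obtain c where "c > 0" and
    c: "\<And>G. G \<in> borel_measurable (line_measure p q ?N) \<Longrightarrow>
      (\<integral>\<^sup>+x. ennreal (bead_weight p q x) * G (x ?N) \<partial>config_measure p q) =
      ennreal c * (\<integral>\<^sup>+y. ennreal (line_pdf p q ?N 1 y) * G y \<partial>line_measure p q ?N)"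
    by blast
  have "(\<integral>\<^sup>+x. ennreal (bead_weight p q x) \<partial>config_measure p q) = ennreal (c * C)"
    using c[of "\<lambda>_. 1"] total \<open>c > 0\<close> \<open>C > 0\<close> by (simp add: ennreal_mult)
  then show ?thesis
    using \<open>c > 0\<close> \<open>C > 0\<close> by (intro exI[of _ "c * C"]) simp
qed

theorem proposition3p1:
  fixes p q t :: nat
  assumes "1 \<le> p" and "p \<le> q" and "t \<in> {1..p + q - 1}"
  shows "prob_space (bead_process p q) \<and>
    (\<exists>Z>0. distributed (bead_process p q) (line_measure p q t) (\<lambda>x. x t)
             (\<lambda>x. ennreal (line_pdf p q t Z x)))"
proof -
  let ?M = "config_measure p q" and ?L = "line_measure p q t"
  note pq = assms(1,2)
  note borel_measurable_bead_weight[OF pq, measurable]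
  obtain w where "w > 0" and w: "(\<integral>\<^sup>+x. ennreal (bead_weight p q x) \<partial>?M) = ennreal w"
    using nn_integral_bead_weight_total[OF pq] by blast
  obtain c where "c > 0" and c: "\<And>G. G \<in> borel_measurable ?L \<Longrightarrow>
      (\<integral>\<^sup>+x. ennreal (bead_weight p q x) * G (x t) \<partial>?M) =
      ennreal c * (\<integral>\<^sup>+y. ennreal (line_pdf p q t 1 y) * G y \<partial>?L)"
    using nn_integral_bead_weight[OF assms] by blast
  \<comment> \<open>The normalizer in \<open>bead_pdf\<close> is a Bochner integral; nonnegativity
    of the weight identifies it with the positive finite mass \<open>w\<close>.\<close>
  have "(LINT y|?M. bead_weight p q y) = w"
    using \<open>w > 0\<close> by (subst integral_eq_nn_integral) (simp_all add: w bead_weight_nonneg[OF pq])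
  then have pdf: "ennreal (bead_pdf p q x) = ennreal (inverse w) * ennreal (bead_weight p q x)" for x
    using \<open>w > 0\<close> by (simp add: bead_pdf_def divide_inverse mult.commute bead_weight_nonneg[OF pq] flip: ennreal_mult)
  have comp: "(\<lambda>x. x t) \<in> ?M \<rightarrow>\<^sub>M ?L"
    unfolding config_measure_def using assms(3) by (rule measurable_component_singleton)
  have bead: "bead_process p q = density ?M (\<lambda>x. ennreal (inverse w) * ennreal (bead_weight p q x))"
    unfolding bead_process_def pdf ..
  have "emeasure (bead_process p q) (space (bead_process p q)) = ennreal (inverse w) * ennreal w"
    unfolding bead by (simp add: emeasure_density nn_integral_cmult w cong: nn_integral_cong)
  also have "\<dots> = 1"
    using \<open>w > 0\<close> by (simp flip: ennreal_mult)
  finally have "prob_space (bead_process p q)"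
    by (rule prob_spaceI)
  \<comment> \<open>Integrating out the other lines multiplies by \<open>c\<close> and normalizing
    divides by \<open>w\<close>, hence \<open>Z = w / c\<close>. The measures are compared on a set
    \<open>A\<close> by taking its indicator as test function.\<close>
  moreover have "distributed (bead_process p q) ?L (\<lambda>x. x t) (\<lambda>x. ennreal (line_pdf p q t (w / c) x))"
    unfolding distributed_def
  proof (intro conjI measure_eqI)
    fix A assume "A \<in> sets (distr (bead_process p q) ?L (\<lambda>x. x t))"
    then have A[measurable]: "A \<in> sets ?L" by simp
    have "emeasure (distr (bead_process p q) ?L (\<lambda>x. x t)) A =
        (\<integral>\<^sup>+x. ennreal (inverse w) * (ennreal (bead_weight p q x) * indicator A (x t)) \<partial>?M)"
    proof -
      have "emeasure (distr (bead_process p q) ?L (\<lambda>x. x t)) A =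
        emeasure (bead_process p q) ((\<lambda>x. x t) -` A \<inter> space ?M)"
        by (subst emeasure_distr) (use comp in \<open>simp_all add: bead\<close>)
      also have "\<dots> = (\<integral>\<^sup>+x. ennreal (inverse w) * ennreal (bead_weight p q x) * indicator ((\<lambda>x. x t) -` A \<inter> space ?M) x \<partial>?M)"
        unfolding bead by (rule emeasure_density) (use measurable_sets[OF comp A] in simp_all)
      also have "\<dots> = (\<integral>\<^sup>+x. ennreal (inverse w) * (ennreal (bead_weight p q x) * indicator A (x t)) \<partial>?M)"
        by (intro nn_integral_cong) (simp add: indicator_def)
      finally show ?thesis .
    qed
    also have "\<dots> = ennreal (inverse w) * (\<integral>\<^sup>+x. ennreal (bead_weight p q x) * indicator A (x t) \<partial>?M)"
      using measurable_compose[OF comp borel_measurable_indicator[OF A]]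
      by (intro nn_integral_cmult borel_measurable_times_ennreal) simp_all
    also have "\<dots> = ennreal (inverse w) * (ennreal c * (\<integral>\<^sup>+y. ennreal (line_pdf p q t 1 y) * indicator A y \<partial>?L))"
      by (subst c) simp_all
    also have "\<dots> = (\<integral>\<^sup>+y. ennreal (c / w) * (ennreal (line_pdf p q t 1 y) * indicator A y) \<partial>?L)"
      using \<open>c > 0\<close> \<open>w > 0\<close>
      by (subst nn_integral_cmult) (simp_all add: divide_inverse ennreal_mult mult_ac)
    also have "\<dots> = (\<integral>\<^sup>+y. ennreal (line_pdf p q t (w / c) y) * indicator A y \<partial>?L)"
    proof (rule nn_integral_cong)
      fix y
      have "line_pdf p q t (w / c) y = c / w * line_pdf p q t 1 y"
        by (simp add: line_pdf_def)
      then have "ennreal (line_pdf p q t (w / c) y) = ennreal (c / w) * ennreal (line_pdf p q t 1 y)"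
        using \<open>c > 0\<close> \<open>w > 0\<close> by (simp only: ennreal_mult' divide_nonneg_nonneg less_imp_le)
      then show "ennreal (c / w) * (ennreal (line_pdf p q t 1 y) * indicator A y) = ennreal (line_pdf p q t (w / c) y) * indicator A y"
        by (simp only: mult.assoc)
    qed
    also have "\<dots> = emeasure (density ?L (\<lambda>x. ennreal (line_pdf p q t (w / c) x))) A"
      by (rule emeasure_density[symmetric]) simp_all
    finally show "emeasure (distr (bead_process p q) ?L (\<lambda>x. x t)) A =
      emeasure (density ?L (\<lambda>x. ennreal (line_pdf p q t (w / c) x))) A" .
  qed (use comp in \<open>simp_all add: bead\<close>)
  ultimately show ?thesis
    using \<open>c > 0\<close> \<open>w > 0\<close> by (intro conjI exI[of _ "w / c"]) simp_all
qed

end
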